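(* Let $n\geq 3$, $0<\alpha<1$, and let $\Omega\subset\mathbb{R}^n$ be a bounded domain of class $C^{2+\alpha}$, with hyperbolic radius $v_\Omega$. Let $d(x)$ be the distance from $x$ to $\partial\Omega$, let $\Omega_\delta=\{x\in\Omega: 0<d(x)<\delta\}$ with $\delta>0$ sufficiently small, and let $w:=(v_\Omega-2d)/d^2$. Let $w_0\in C_\sharp^{2+\alpha}(\overline\Omega_\delta)$ be a function satisfying $Lw_0+2\Delta d=0$ in $\Omega_\delta$ and $w_0|_{\partial\Omega}=-H$, where $$L:=d^2\Delta+(4-n)\,d\,\nabla d\cdot\nabla+(2-2n)$$ and $H=-(\Delta d)/(n-1)$ is the mean curvature of $\partial\Omega$. Then, near the boundary $\partial\Omega$, $$\tilde w:=w-w_0=O(d).$$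
   Context: The hyperbolic radius is $v_\Omega=u_\Omega^{-2/(n-2)}$, where the maximal solution $u_\Omega$ is the positive, smooth (in the interior of $\Omega$) solution of $-\Delta u+n(n-2)u^{\frac{n+2}{n-2}}=0$ in $\Omega$ which dominates all classical solutions; it is known to exist, and it is the limit as $m\to\infty$ of the increasing sequence $(u_m)_{m\ge1}$ of solutions of this equation equal to $m$ on $\partial\Omega$. It is understood that $\delta$ is small enough that $d\in C^{2+\alpha}(\overline\Omega_\delta)$ and that $\partial\Omega_\delta=\partial\Omega\cup\Gamma$, $\Gamma=\{d=\delta\}$, consists of two hypersurfaces of class $C^{2+\alpha}$. For an integer $k\ge0$, $C_\sharp^{k+\alpha}(\overline\Omega_\delta)$ is the space of functions $w$ such that $d^jw\in C^{j+\alpha}(\overline\Omega_\delta)$ for every $0\le j\le k$. A function $w_0$ as in the claim exists for $\delta$ sufficiently small. The mean curvature is the average of the principal curvatures, positive for balls. *)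

theory Defs
  imports "HOL-Analysis.Analysis" "HOL-Library.Landau_Symbols"
begin

subsection \<open>Partial derivatives\<close>

text \<open>All derivatives below are only evaluated at points of an open set on which the function
  is differentiable, so that values of the function outside that set are irrelevant.\<close>

definition pderiv_dir :: "'a::euclidean_space \<Rightarrow> ('a \<Rightarrow> 'b::real_normed_vector) \<Rightarrow> 'a \<Rightarrow> 'b" where
  "pderiv_dir i f x = frechet_derivative f (at x) i"

definition grad :: "('a::euclidean_space \<Rightarrow> real) \<Rightarrow> 'a \<Rightarrow> 'a" where
  "grad f x = (\<Sum>i\<in>Basis. pderiv_dir i f x *\<^sub>R i)"

definition laplacian :: "('a::euclidean_space \<Rightarrow> real) \<Rightarrow> 'a \<Rightarrow> real" where
  "laplacian f x = (\<Sum>i\<in>Basis. pderiv_dir i (pderiv_dir i f) x)"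

primrec Ck_on :: "nat \<Rightarrow> 'a::euclidean_space set \<Rightarrow> ('a \<Rightarrow> 'b::real_normed_vector) \<Rightarrow> bool" where
  "Ck_on 0 U f \<longleftrightarrow> continuous_on U f"
| "Ck_on (Suc k) U f \<longleftrightarrow>
     (\<forall>x\<in>U. f differentiable (at x)) \<and> (\<forall>i\<in>Basis. Ck_on k U (pderiv_dir i f))"

definition smooth_on :: "'a::euclidean_space set \<Rightarrow> ('a \<Rightarrow> 'b::real_normed_vector) \<Rightarrow> bool" where
  "smooth_on U f \<longleftrightarrow> (\<forall>k. Ck_on k U f)"

subsection \<open>Hoelder spaces\<close>

definition extends_continuously ::
    "'a::euclidean_space set \<Rightarrow> ('a \<Rightarrow> 'b::real_normed_vector) \<Rightarrow> bool" where
  "extends_continuously U f \<longleftrightarrow>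
     (\<exists>g. continuous_on (closure U) g \<and> (\<forall>x\<in>U. g x = f x))"

definition holder_continuous_on ::
    "real \<Rightarrow> 'a::euclidean_space set \<Rightarrow> ('a \<Rightarrow> 'b::real_normed_vector) \<Rightarrow> bool" where
  "holder_continuous_on \<alpha> U f \<longleftrightarrow>
     (\<exists>C. \<forall>x\<in>U. \<forall>y\<in>U. norm (f x - f y) \<le> C * dist x y powr \<alpha>)"

primrec holder_derivs ::
    "nat \<Rightarrow> real \<Rightarrow> 'a::euclidean_space set \<Rightarrow> ('a \<Rightarrow> 'b::real_normed_vector) \<Rightarrow> bool" where
  "holder_derivs 0 \<alpha> U f \<longleftrightarrow> extends_continuously U f \<and> holder_continuous_on \<alpha> U f"
| "holder_derivs (Suc k) \<alpha> U f \<longleftrightarrow>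
     extends_continuously U f \<and> (\<forall>x\<in>U. f differentiable (at x)) \<and>
     (\<forall>i\<in>Basis. holder_derivs k \<alpha> U (pderiv_dir i f))"

text \<open>The space of functions of class \<open>C\<close> with exponent \<open>k + \<alpha>\<close> on the closure of the bounded
  open set \<open>U\<close>: the derivatives of order at most \<open>k\<close> exist in \<open>U\<close> and extend continuously to the
  closure, those of order \<open>k\<close> being uniformly Hoelder continuous in \<open>U\<close>. The set argument is \<open>U\<close>,
  not its closure; the function itself is given on the closure, which gives a meaning to its
  values on the boundary.\<close>

definition holder_space ::
    "nat \<Rightarrow> real \<Rightarrow> 'a::euclidean_space set \<Rightarrow> ('a \<Rightarrow> 'b::real_normed_vector) set" where
  "holder_space k \<alpha> U = {f. continuous_on (closure U) f \<and> holder_derivs k \<alpha> U f}"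

subsection \<open>Hypersurfaces and domains of Hoelder class\<close>

definition holder_diffeo :: "nat \<Rightarrow> real \<Rightarrow> 'a::euclidean_space set \<Rightarrow> 'a set \<Rightarrow>
    ('a \<Rightarrow> 'a) \<Rightarrow> ('a \<Rightarrow> 'a) \<Rightarrow> bool" where
  "holder_diffeo k \<alpha> B D \<psi> \<phi> \<longleftrightarrow>
     open B \<and> open D \<and> homeomorphism B D \<psi> \<phi> \<and>
     \<psi> \<in> holder_space k \<alpha> B \<and> \<phi> \<in> holder_space k \<alpha> D"

definition holder_hypersurface :: "nat \<Rightarrow> real \<Rightarrow> 'a::euclidean_space set \<Rightarrow> bool" where
  "holder_hypersurface k \<alpha> S \<longleftrightarrow>
     (\<forall>p\<in>S. \<exists>r>0. \<exists>D \<psi> \<phi>. \<exists>e\<in>Basis. holder_diffeo k \<alpha> (ball p r) D \<psi> \<phi> \<and>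
        \<psi> ` (ball p r \<inter> S) = D \<inter> {y. y \<bullet> e = 0})"

text \<open>Local straightening of the boundary, with the domain on one side of it. That the charts are
  regular up to the closure of the ball is no restriction, since the ball may be shrunk.\<close>

definition holder_domain :: "nat \<Rightarrow> real \<Rightarrow> 'a::euclidean_space set \<Rightarrow> bool" where
  "holder_domain k \<alpha> \<Omega> \<longleftrightarrow>
     open \<Omega> \<and> connected \<Omega> \<and> \<Omega> \<noteq> {} \<and>
     (\<forall>p\<in>frontier \<Omega>. \<exists>r>0. \<exists>D \<psi> \<phi>. \<exists>e\<in>Basis. holder_diffeo k \<alpha> (ball p r) D \<psi> \<phi> \<and>
        \<psi> ` (ball p r \<inter> \<Omega>) = D \<inter> {y. y \<bullet> e > 0} \<and>
        \<psi> ` (ball p r \<inter> frontier \<Omega>) = D \<inter> {y. y \<bullet> e = 0})"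

subsection \<open>The distance to the boundary\<close>

definition bdist :: "'a::euclidean_space set \<Rightarrow> 'a \<Rightarrow> real" where
  "bdist \<Omega> x = infdist x (frontier \<Omega>)"

definition strip :: "'a::euclidean_space set \<Rightarrow> real \<Rightarrow> 'a set" where
  "strip \<Omega> \<delta> = {x\<in>\<Omega>. 0 < bdist \<Omega> x \<and> bdist \<Omega> x < \<delta>}"

definition near_boundary :: "'a::euclidean_space set \<Rightarrow> 'a filter" where
  "near_boundary \<Omega> = (INF \<epsilon>\<in>{0<..}. principal (strip \<Omega> \<epsilon>))"

lemma eventually_near_boundary:
  "eventually P (near_boundary \<Omega>) \<longleftrightarrow> (\<exists>\<epsilon>>0. \<forall>x\<in>strip \<Omega> \<epsilon>. P x)"
  unfolding near_boundary_def
proof (subst eventually_INF_base)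
  show "{0<..} \<noteq> ({} :: real set)"
    by (auto intro: exI[of _ 1])
  show "\<exists>x\<in>{0<..}. principal (strip \<Omega> x) \<le> inf (principal (strip \<Omega> a)) (principal (strip \<Omega> b))"
    if "a \<in> {0<..}" "b \<in> {0<..}" for a b :: real
    using that by (intro bexI[of _ "min a b"]) (auto simp: strip_def)
qed (auto simp: eventually_principal)

text \<open>What it means for \<open>\<delta>\<close> to be sufficiently small.\<close>

definition admissible_width :: "real \<Rightarrow> 'a::euclidean_space set \<Rightarrow> real \<Rightarrow> bool" where
  "admissible_width \<alpha> \<Omega> \<delta> \<longleftrightarrow>
     0 < \<delta> \<and>
     bdist \<Omega> \<in> holder_space 2 \<alpha> (strip \<Omega> \<delta>) \<and>
     frontier (strip \<Omega> \<delta>) = frontier \<Omega> \<union> {x\<in>\<Omega>. bdist \<Omega> x = \<delta>} \<and>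
     holder_hypersurface 2 \<alpha> (frontier \<Omega>) \<and>
     holder_hypersurface 2 \<alpha> {x\<in>\<Omega>. bdist \<Omega> x = \<delta>}"

definition holder_sharp_space ::
    "nat \<Rightarrow> real \<Rightarrow> 'a::euclidean_space set \<Rightarrow> real \<Rightarrow> ('a \<Rightarrow> real) set" where
  "holder_sharp_space k \<alpha> \<Omega> \<delta> =
     {w. \<forall>j\<le>k. (\<lambda>x. bdist \<Omega> x ^ j * w x) \<in> holder_space j \<alpha> (strip \<Omega> \<delta>)}"

text \<open>The function \<open>bdist \<Omega>\<close> is not differentiable on the boundary itself; there its Laplacian is
  the continuous extension of the Laplacian from inside \<open>\<Omega>\<close>.\<close>

definition mean_curvature :: "'a::euclidean_space set \<Rightarrow> 'a \<Rightarrow> real" where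
  "mean_curvature \<Omega> y = - Lim (at y within \<Omega>) (laplacian (bdist \<Omega>)) / (real DIM('a) - 1)"

subsection \<open>The maximal solution and the hyperbolic radius\<close>

definition classical_solution :: "'a::euclidean_space set \<Rightarrow> ('a \<Rightarrow> real) \<Rightarrow> bool" where
  "classical_solution \<Omega> u \<longleftrightarrow>
     Ck_on 2 \<Omega> u \<and> (\<forall>x\<in>\<Omega>. u x > 0) \<and>
     (\<forall>x\<in>\<Omega>. let n = real DIM('a) in
        - laplacian u x + n * (n - 2) * u x powr ((n + 2) / (n - 2)) = 0)"

definition maximal_solution :: "'a::euclidean_space set \<Rightarrow> ('a \<Rightarrow> real) \<Rightarrow> bool" where
  "maximal_solution \<Omega> u \<longleftrightarrow>
     classical_solution \<Omega> u \<and> smooth_on \<Omega> u \<and>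
     (\<forall>u'. classical_solution \<Omega> u' \<longrightarrow> (\<forall>x\<in>\<Omega>. u' x \<le> u x))"

text \<open>The hyperbolic radius as a function of the maximal solution \<open>u\<close>, which is unique on \<open>\<Omega>\<close>.\<close>

definition hyperbolic_radius :: "('a::euclidean_space \<Rightarrow> real) \<Rightarrow> 'a \<Rightarrow> real" where
  "hyperbolic_radius u x = u x powr (- 2 / (real DIM('a) - 2))"

definition L_op :: "'a::euclidean_space set \<Rightarrow> ('a \<Rightarrow> real) \<Rightarrow> 'a \<Rightarrow> real" where
  "L_op \<Omega> w x = (let n = real DIM('a); d = bdist \<Omega> in
     (d x)\<^sup>2 * laplacian w x + (4 - n) * d x * (grad d x \<bullet> grad w x) + (2 - 2 * n) * w x)"

end

theory Submission
  imports Defs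
begin

text \<open>Write \<open>d\<close> for the distance to the boundary, \<open>n\<close> for the dimension and \<open>v\<close> for the hyperbolic
radius. Substituting \<open>u = v powr (- (n - 2) / 2)\<close> turns the equation for the maximal solution into
\<open>F v = 0\<close>, where \<open>F v = v \<Delta>v - (n / 2) (\<bar>\<nabla>v\<bar>\<^sup>2 - 4)\<close>. The proof squeezes \<open>v\<close> between explicit functions
with \<open>F \<ge> 0\<close> (from below) and \<open>F \<le> 0\<close> (from above).

The comparison is carried out on ratios: at an interior maximum of \<open>a / b\<close> with value \<open>\<tau> > 1\<close> one has
\<open>\<nabla>a = \<tau> \<nabla>b\<close> and \<open>\<Delta>a \<le> \<tau> \<Delta>b\<close>, and since every term of \<open>F\<close> but the constant \<open>2 n\<close> is homogeneous
of degree two, \<open>F a \<ge> 0 \<ge> F b\<close> forces \<open>\<tau>\<^sup>2 \<le> 1\<close> (\<open>radius_comparison\<close>). Because only ratios matter,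
it is enough that the two functions are asymptotically equal at the boundary, even though both
vanish there.

The bounds are obtained in three rounds, each supplying the boundary behaviour for the next.

First, \<open>v\<close> tends to \<open>0\<close> at the boundary (\<open>hyperbolic_radius_vanishes\<close>). The exterior of a ball has
the explicit solution with radius \<open>(\<bar>x - z\<bar>\<^sup>2 - \<rho>\<^sup>2) / \<rho>\<close>, and maximality of \<open>u\<close> turns every ball outside
\<open>\<Omega>\<close> into an upper bound for \<open>v\<close>. The charts provide, near each boundary point, balls of every small
radius \<open>\<rho>\<close> at a distance comparable to \<open>\<rho>\<close>, and the resulting bound is a multiple of \<open>\<rho>\<close>.

Secondly, \<open>\<bar>v - 2 d\<bar> \<le> K d\<^sup>2\<close> (\<open>boundary_expansion_first_order\<close>), by comparison with \<open>2 s \<plusminus> K s\<^sup>2\<close>, where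
\<open>s = d \<plusminus> \<epsilon>\<close> is a shifted distance and \<open>\<epsilon>\<close> tends to \<open>0\<close>; here \<open>\<bar>\<nabla>d\<bar> = 1\<close> and the boundedness of \<open>\<Delta>d\<close>
enter.

Thirdly, \<open>\<bar>v - 2 d - d\<^sup>2 w\<^sub>0\<bar> \<le> A d\<^sup>3\<close> (\<open>boundary_expansion_second_order\<close>), by comparison with
\<open>2 d + d\<^sup>2 (w\<^sub>0 \<plusminus> A d)\<close>. For \<open>W = w\<^sub>0 + c d\<close> the expression \<open>F (2 d + d\<^sup>2 W)\<close> equals
\<open>d (2 + d W) (L W + 2 \<Delta>d)\<close> up to terms of order \<open>d\<^sup>2\<close>. The equation for \<open>w\<^sub>0\<close> reduces \<open>L W + 2 \<Delta>d\<close> to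
\<open>c L d = - c (3 (n - 2) d - d\<^sup>2 \<Delta>d)\<close>: the exponent \<open>1\<close> lies strictly between the indicial roots \<open>-2\<close> and
\<open>n - 1\<close> of \<open>L\<close>, so that \<open>L d\<close> has a strict sign, and a large \<open>A\<close> dominates the error terms.
Dividing by \<open>d\<^sup>2\<close> gives the claim.\<close>

section \<open>Functions with gradient and Laplacian\<close>

text \<open>The Laplacian is recorded as the trace of the derivative of the gradient. In this form sums, products
and compositions follow from the rules for first derivatives, without iterated partial derivatives.\<close>

definition has_grad_laplacian ::
    "'a::euclidean_space set \<Rightarrow> ('a \<Rightarrow> real) \<Rightarrow> ('a \<Rightarrow> 'a) \<Rightarrow> ('a \<Rightarrow> real) \<Rightarrow> bool" where
  "has_grad_laplacian S f g l \<longleftrightarrow>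
     (\<forall>x\<in>S. (f has_derivative (\<lambda>h. g x \<bullet> h)) (at x) \<and>
        (\<exists>H. (g has_derivative H) (at x) \<and> l x = (\<Sum>i\<in>Basis. H i \<bullet> i)))"

lemma has_grad_laplacian_subset:
  "has_grad_laplacian S f g l \<Longrightarrow> T \<subseteq> S \<Longrightarrow> has_grad_laplacian T f g l"
  unfolding has_grad_laplacian_def by blast

lemma has_grad_laplacian_cong:
  assumes "has_grad_laplacian S f g l"
    and "\<And>x. x \<in> S \<Longrightarrow> l x = l' x"
  shows "has_grad_laplacian S f g l'"
  using assms unfolding has_grad_laplacian_def by metis

lemma has_grad_laplacian_transform:
  assumes "has_grad_laplacian S f g l" "open S"
    and eq: "\<And>x. x \<in> S \<Longrightarrow> f' x = f x"
  shows "has_grad_laplacian S f' g l"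
  unfolding has_grad_laplacian_def
proof
  fix x assume x: "x \<in> S"
  have "(f has_derivative (\<lambda>h. g x \<bullet> h)) (at x)"
    using assms(1) x unfolding has_grad_laplacian_def by blast
  then have "(f' has_derivative (\<lambda>h. g x \<bullet> h)) (at x)"
    by (rule has_derivative_transform_within_open[OF _ assms(2) x]) (simp add: eq)
  then show "(f' has_derivative (\<lambda>h. g x \<bullet> h)) (at x) \<and>
        (\<exists>H. (g has_derivative H) (at x) \<and> l x = (\<Sum>i\<in>Basis. H i \<bullet> i))"
    using assms(1) x unfolding has_grad_laplacian_def by blast
qed

lemma has_grad_laplacian_continuous_on:
  "has_grad_laplacian S f g l \<Longrightarrow> continuous_on S f"
  unfolding has_grad_laplacian_def
  by (meson continuous_at_imp_continuous_on has_derivative_continuous)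

lemma has_grad_laplacian_const:
  "has_grad_laplacian S (\<lambda>x. c) (\<lambda>x. 0) (\<lambda>x. 0)"
  unfolding has_grad_laplacian_def by (auto intro!: derivative_eq_intros exI[of _ "\<lambda>h. 0"])

lemma has_grad_laplacian_add:
  assumes "has_grad_laplacian S f1 g1 l1" "has_grad_laplacian S f2 g2 l2"
  shows "has_grad_laplacian S (\<lambda>x. f1 x + f2 x) (\<lambda>x. g1 x + g2 x) (\<lambda>x. l1 x + l2 x)"
  unfolding has_grad_laplacian_def
proof
  fix x assume x: "x \<in> S"
  obtain H1 where 1: "(f1 has_derivative (\<lambda>h. g1 x \<bullet> h)) (at x)"
    "(g1 has_derivative H1) (at x)" "l1 x = (\<Sum>i\<in>Basis. H1 i \<bullet> i)"
    using assms(1) x unfolding has_grad_laplacian_def by blast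
  obtain H2 where 2: "(f2 has_derivative (\<lambda>h. g2 x \<bullet> h)) (at x)"
    "(g2 has_derivative H2) (at x)" "l2 x = (\<Sum>i\<in>Basis. H2 i \<bullet> i)"
    using assms(2) x unfolding has_grad_laplacian_def by blast
  have "((\<lambda>x. g1 x + g2 x) has_derivative (\<lambda>h. H1 h + H2 h)) (at x)"
    by (intro derivative_intros 1 2)
  moreover have "((\<lambda>x. f1 x + f2 x) has_derivative (\<lambda>h. (g1 x + g2 x) \<bullet> h)) (at x)"
    using has_derivative_add[OF 1(1) 2(1)] by (simp add: inner_add_left)
  ultimately show "((\<lambda>x. f1 x + f2 x) has_derivative (\<lambda>h. (g1 x + g2 x) \<bullet> h)) (at x) \<and>
    (\<exists>H. ((\<lambda>x. g1 x + g2 x) has_derivative H) (at x) \<and> l1 x + l2 x = (\<Sum>i\<in>Basis. H i \<bullet> i))"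
    by (intro conjI exI[of _ "\<lambda>h. H1 h + H2 h"]) (auto simp: 1 2 inner_add_left sum.distrib)
qed

lemma has_grad_laplacian_mult:
  assumes "has_grad_laplacian S f1 g1 l1" "has_grad_laplacian S f2 g2 l2"
  shows "has_grad_laplacian S (\<lambda>x. f1 x * f2 x) (\<lambda>x. f1 x *\<^sub>R g2 x + f2 x *\<^sub>R g1 x)
    (\<lambda>x. f1 x * l2 x + f2 x * l1 x + 2 * (g1 x \<bullet> g2 x))"
  unfolding has_grad_laplacian_def
proof
  fix x assume x: "x \<in> S"
  obtain H1 where 1: "(f1 has_derivative (\<lambda>h. g1 x \<bullet> h)) (at x)"
    "(g1 has_derivative H1) (at x)" "l1 x = (\<Sum>i\<in>Basis. H1 i \<bullet> i)"
    using assms(1) x unfolding has_grad_laplacian_def by blast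
  obtain H2 where 2: "(f2 has_derivative (\<lambda>h. g2 x \<bullet> h)) (at x)"
    "(g2 has_derivative H2) (at x)" "l2 x = (\<Sum>i\<in>Basis. H2 i \<bullet> i)"
    using assms(2) x unfolding has_grad_laplacian_def by blast
  define H where "H h = f1 x *\<^sub>R H2 h + (g1 x \<bullet> h) *\<^sub>R g2 x + (f2 x *\<^sub>R H1 h + (g2 x \<bullet> h) *\<^sub>R g1 x)" for h
  have "((\<lambda>x. f1 x *\<^sub>R g2 x + f2 x *\<^sub>R g1 x) has_derivative H) (at x)"
    unfolding H_def by (intro derivative_intros 1 2)
  moreover have "((\<lambda>x. f1 x * f2 x) has_derivative (\<lambda>h. (f1 x *\<^sub>R g2 x + f2 x *\<^sub>R g1 x) \<bullet> h)) (at x)"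
    using has_derivative_mult[OF 1(1) 2(1)] by (simp add: inner_add_left mult.commute)
  moreover have "f1 x * l2 x + f2 x * l1 x + 2 * (g1 x \<bullet> g2 x) = (\<Sum>i\<in>Basis. H i \<bullet> i)"
    unfolding H_def
    by (simp add: inner_add_left sum.distrib 1 2 sum_distrib_left euclidean_inner[of "g1 x" "g2 x"] mult.commute)
  ultimately show "((\<lambda>x. f1 x * f2 x) has_derivative (\<lambda>h. (f1 x *\<^sub>R g2 x + f2 x *\<^sub>R g1 x) \<bullet> h)) (at x) \<and>
    (\<exists>H. ((\<lambda>x. f1 x *\<^sub>R g2 x + f2 x *\<^sub>R g1 x) has_derivative H) (at x) \<and>
      f1 x * l2 x + f2 x * l1 x + 2 * (g1 x \<bullet> g2 x) = (\<Sum>i\<in>Basis. H i \<bullet> i))"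
    by blast
qed

text \<open>The derivatives of \<open>\<phi>\<close> are required only at values of \<open>f\<close>, so that powers of positive functions
are covered.\<close>

lemma has_grad_laplacian_compose:
  assumes "has_grad_laplacian S f g l"
    and 1: "\<And>x. x \<in> S \<Longrightarrow> (\<phi> has_real_derivative \<phi>' (f x)) (at (f x))"
    and 2: "\<And>x. x \<in> S \<Longrightarrow> (\<phi>' has_real_derivative \<phi>'' (f x)) (at (f x))"
  shows "has_grad_laplacian S (\<lambda>x. \<phi> (f x)) (\<lambda>x. \<phi>' (f x) *\<^sub>R g x)
    (\<lambda>x. \<phi>' (f x) * l x + \<phi>'' (f x) * (g x \<bullet> g x))"
  unfolding has_grad_laplacian_def
proof
  fix x assume x: "x \<in> S"
  obtain H where H: "(f has_derivative (\<lambda>h. g x \<bullet> h)) (at x)"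
    "(g has_derivative H) (at x)" "l x = (\<Sum>i\<in>Basis. H i \<bullet> i)"
    using assms(1) x unfolding has_grad_laplacian_def by blast
  have d1: "((\<lambda>x. \<phi> (f x)) has_derivative (\<lambda>h. \<phi>' (f x) * (g x \<bullet> h))) (at x)"
    using has_derivative_compose[OF H(1), of \<phi> "(*) (\<phi>' (f x))"] 1[OF x]
    by (simp add: has_field_derivative_def)
  have d2: "((\<lambda>x. \<phi>' (f x)) has_derivative (\<lambda>h. \<phi>'' (f x) * (g x \<bullet> h))) (at x)"
    using has_derivative_compose[OF H(1), of \<phi>' "(*) (\<phi>'' (f x))"] 2[OF x]
    by (simp add: has_field_derivative_def)
  define K where "K h = \<phi>' (f x) *\<^sub>R H h + (\<phi>'' (f x) * (g x \<bullet> h)) *\<^sub>R g x" for h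
  have "((\<lambda>x. \<phi>' (f x) *\<^sub>R g x) has_derivative K) (at x)"
    unfolding K_def by (intro derivative_intros d2 H)
  moreover have "\<phi>' (f x) * l x + \<phi>'' (f x) * (g x \<bullet> g x) = (\<Sum>i\<in>Basis. K i \<bullet> i)"
    unfolding K_def
    by (simp add: inner_add_left sum.distrib H sum_distrib_left euclidean_inner[of "g x" "g x"] mult.assoc)
  ultimately show "((\<lambda>x. \<phi> (f x)) has_derivative (\<lambda>h. (\<phi>' (f x) *\<^sub>R g x) \<bullet> h)) (at x) \<and>
    (\<exists>H. ((\<lambda>x. \<phi>' (f x) *\<^sub>R g x) has_derivative H) (at x) \<and>
       \<phi>' (f x) * l x + \<phi>'' (f x) * (g x \<bullet> g x) = (\<Sum>i\<in>Basis. H i \<bullet> i))"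
    using d1 by auto
qed

lemma has_grad_laplacian_cmult:
  assumes "has_grad_laplacian S f g l"
  shows "has_grad_laplacian S (\<lambda>x. c * f x) (\<lambda>x. c *\<^sub>R g x) (\<lambda>x. c * l x)"
  using has_grad_laplacian_mult[OF has_grad_laplacian_const[of S c] assms] by simp

lemma has_derivative_grad:
  assumes "f differentiable (at x)"
  shows "(f has_derivative (\<lambda>h. grad f x \<bullet> h)) (at x)"
proof -
  have D: "(f has_derivative frechet_derivative f (at x)) (at x)"
    using assms frechet_derivative_works by blast
  then have "linear (frechet_derivative f (at x))"
    by (rule has_derivative_linear)
  then have "frechet_derivative f (at x) h = grad f x \<bullet> h" for h
  proof -
    assume lin: "linear (frechet_derivative f (at x))"
    have "frechet_derivative f (at x) h = frechet_derivative f (at x) (\<Sum>i\<in>Basis. (h \<bullet> i) *\<^sub>R i)"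
      by (simp add: euclidean_representation)
    also have "\<dots> = (\<Sum>i\<in>Basis. (h \<bullet> i) * pderiv_dir i f x)"
      by (simp add: linear_sum[OF lin] linear_cmul[OF lin] pderiv_dir_def)
    also have "\<dots> = grad f x \<bullet> h"
      unfolding grad_def inner_sum_left by (simp add: mult.commute inner_commute)
    finally show ?thesis .
  qed
  then have "frechet_derivative f (at x) = (\<lambda>h. grad f x \<bullet> h)" by auto
  with D show ?thesis by simp
qed

text \<open>Once all first partial derivatives are differentiable, so is the gradient that they make up, and the
trace of its derivative picks out the pure second partial derivatives.\<close>

lemma has_grad_laplacianI:
  assumes "\<And>x. x \<in> S \<Longrightarrow> f differentiable (at x)"
    and "\<And>x i. x \<in> S \<Longrightarrow> i \<in> Basis \<Longrightarrow> pderiv_dir i f differentiable (at x)"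
  shows "has_grad_laplacian S f (grad f) (laplacian f)"
  unfolding has_grad_laplacian_def
proof
  fix x assume x: "x \<in> S"
  define H where "H h = (\<Sum>i\<in>Basis. frechet_derivative (pderiv_dir i f) (at x) h *\<^sub>R i)" for h :: 'a
  have gr: "grad f = (\<lambda>y. \<Sum>i\<in>Basis. pderiv_dir i f y *\<^sub>R i)"
    by (auto simp: grad_def)
  have "(grad f has_derivative H) (at x)"
    unfolding gr H_def
    by (intro derivative_intros) (use assms(2)[OF x] frechet_derivative_works in blast)
  moreover have "laplacian f x = (\<Sum>i\<in>Basis. H i \<bullet> i)"
    unfolding laplacian_def
    by (rule sum.cong[OF refl])
       (simp add: H_def pderiv_dir_def inner_sum_left inner_Basis if_distrib cong: if_cong)
  ultimately show "(f has_derivative (\<lambda>h. grad f x \<bullet> h)) (at x) \<and>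
        (\<exists>H. (grad f has_derivative H) (at x) \<and> laplacian f x = (\<Sum>i\<in>Basis. H i \<bullet> i))"
    using has_derivative_grad[OF assms(1)[OF x]] by blast
qed

lemma has_grad_laplacian_pderiv:
  assumes "has_grad_laplacian S f g l" "x \<in> S"
  shows "pderiv_dir i f x = g x \<bullet> i"
  using assms unfolding has_grad_laplacian_def pderiv_dir_def
  by (metis frechet_derivative_at)

text \<open>Openness of \<open>S\<close> is what allows the partial derivatives, which agree with the components of
\<open>g\<close> on \<open>S\<close> only, to be differentiated once more.\<close>

lemma has_grad_laplacianD:
  assumes "has_grad_laplacian S f g l" "open S" "x \<in> S"
  shows "grad f x = g x" "laplacian f x = l x"
    "f differentiable (at x)" "pderiv_dir i f differentiable (at x)"
proof -
  show "grad f x = g x"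
    unfolding grad_def using has_grad_laplacian_pderiv[OF assms(1,3)]
    by (simp add: euclidean_representation)
  obtain H where H: "(f has_derivative (\<lambda>h. g x \<bullet> h)) (at x)"
    "(g has_derivative H) (at x)" "l x = (\<Sum>i\<in>Basis. H i \<bullet> i)"
    using assms(1,3) unfolding has_grad_laplacian_def by blast
  have d: "(pderiv_dir i f has_derivative (\<lambda>h. H h \<bullet> i)) (at x)" for i
  proof -
    have "((\<lambda>y. g y \<bullet> i) has_derivative (\<lambda>h. H h \<bullet> i)) (at x)"
      by (rule has_derivative_inner_left[OF H(2)])
    then show ?thesis
      by (rule has_derivative_transform_within_open[OF _ assms(2,3)])
         (simp add: has_grad_laplacian_pderiv[OF assms(1)])
  qed
  then have "pderiv_dir i (pderiv_dir i f) x = H i \<bullet> i" for i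
    unfolding pderiv_dir_def[of i "pderiv_dir i f"]
    by (metis frechet_derivative_at)
  then show "laplacian f x = l x"
    unfolding laplacian_def H by simp
  show "f differentiable (at x)" "pderiv_dir i f differentiable (at x)"
    using H(1) d by (auto simp: differentiable_def)
qed

text \<open>If some pure second derivative were positive, the first derivative along that coordinate line would
be positive just beyond the maximum and \<open>f\<close> would increase there.\<close>

lemma interior_max_grad_laplacian:
  assumes "has_grad_laplacian S f g l" "open S" "x \<in> S" and mx: "\<And>y. y \<in> S \<Longrightarrow> f y \<le> f x"
  shows "g x = 0" "l x \<le> 0"
proof -
  obtain H where H: "(f has_derivative (\<lambda>h. g x \<bullet> h)) (at x)"
    "(g has_derivative H) (at x)" "l x = (\<Sum>i\<in>Basis. H i \<bullet> i)"
    using assms(1,3) unfolding has_grad_laplacian_def by blast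
  have "(\<lambda>h. g x \<bullet> h) = (\<lambda>h. 0)"
    by (rule differential_zero_maxmin[OF assms(3,2) H(1)]) (use mx in blast)
  then show g0: "g x = 0"
    by (metis inner_eq_zero_iff)
  have "H i \<bullet> i \<le> 0" if i: "i \<in> Basis" for i
  proof (rule ccontr)
    assume "\<not> H i \<bullet> i \<le> 0"
    define \<gamma> where "\<gamma> t = g (x + t *\<^sub>R i) \<bullet> i" for t
    have lin: "linear H" using H(2) by (rule has_derivative_linear)
    have "((\<lambda>t. x + t *\<^sub>R i) has_derivative (\<lambda>t. t *\<^sub>R i)) (at 0)"
      by (auto intro!: derivative_eq_intros)
    then have "((\<lambda>t. g (x + t *\<^sub>R i)) has_derivative (\<lambda>t. H (t *\<^sub>R i))) (at 0)"
      by (rule has_derivative_compose[where g = g]) (simp add: H(2))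
    then have "((\<lambda>t. g (x + t *\<^sub>R i) \<bullet> i) has_derivative (\<lambda>t. H (t *\<^sub>R i) \<bullet> i)) (at 0)"
      by (auto intro!: derivative_eq_intros)
    then have "(\<gamma> has_real_derivative H i \<bullet> i) (at 0)"
      unfolding has_field_derivative_def \<gamma>_def
      by (simp add: linear_cmul[OF lin] mult_commute_abs)
    from DERIV_pos_inc_right[OF this] obtain e where e: "e > 0"
      "\<And>h. 0 < h \<Longrightarrow> h < e \<Longrightarrow> \<gamma> 0 < \<gamma> h"
      using \<open>\<not> H i \<bullet> i \<le> 0\<close> by auto
    obtain r where r: "r > 0" "ball x r \<subseteq> S"
      using assms(2,3) by (meson openE)
    define t where "t = min e r / 2"
    have t: "0 < t" "t < e" "t < r" using e r by (auto simp: t_def)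
    have inS: "x + s *\<^sub>R i \<in> S" if "0 \<le> s" "s \<le> t" for s
      using that t i r(2) by (auto simp: subset_iff dist_norm)
    have der: "((\<lambda>s. f (x + s *\<^sub>R i)) has_real_derivative \<gamma> s) (at s)" if "0 \<le> s" "s \<le> t" for s
    proof -
      have "((\<lambda>t. x + t *\<^sub>R i) has_derivative (\<lambda>t. t *\<^sub>R i)) (at s)"
        by (auto intro!: derivative_eq_intros)
      then have "((\<lambda>t. f (x + t *\<^sub>R i)) has_derivative (\<lambda>t. g (x + s *\<^sub>R i) \<bullet> (t *\<^sub>R i))) (at s)"
        by (rule has_derivative_compose[where g = f])
           (use assms(1) inS[OF that] in \<open>auto simp: has_grad_laplacian_def\<close>)
      then show ?thesis
        unfolding has_field_derivative_def \<gamma>_def by (simp add: mult_commute_abs)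
    qed
    obtain s where s: "0 < s" "s < t" "f (x + t *\<^sub>R i) - f (x + 0 *\<^sub>R i) = (t - 0) * \<gamma> s"
      using MVT2[OF t(1), of "\<lambda>s. f (x + s *\<^sub>R i)" \<gamma>] der by metis
    have "\<gamma> s > 0"
      using e(2)[of s] s t g0 by (simp add: \<gamma>_def)
    then have "f (x + t *\<^sub>R i) > f x"
      using s t by (simp add: algebra_simps)
    with mx[OF inS[of t]] t show False by simp
  qed
  then show "l x \<le> 0" unfolding H by (simp add: sum_nonpos)
qed

section \<open>The equation for the hyperbolic radius and its comparison principle\<close>

text \<open>For \<open>v = u powr (- 2 / (n - 2))\<close> the equation \<open>- \<Delta>u + n (n - 2) u powr ((n + 2) / (n - 2)) = 0\<close> says
that this expression, taken at \<open>v\<close>, \<open>\<nabla>v\<close> and \<open>\<Delta>v\<close>, vanishes. It is quadratic, which suits the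
polynomial barriers below.\<close>

definition radius_defect :: "real \<Rightarrow> 'a::euclidean_space \<Rightarrow> real \<Rightarrow> real" where
  "radius_defect v p l = v * l - real DIM('a) / 2 * (p \<bullet> p - 4)"

text \<open>At a maximum point of \<open>a / b\<close> with value \<open>\<tau> > \<sigma>\<close> the function \<open>a - \<tau> b\<close> has an interior maximum. Then
\<open>0 \<le> F a \<le> \<tau>\<^sup>2 F b + 2 n (1 - \<tau>\<^sup>2)\<close> contradicts \<open>F b \<le> 0\<close> and \<open>\<tau> > 1\<close>. The factor \<open>\<sigma>\<close> permits comparison of
functions that are only asymptotically equal at the boundary, and \<open>a\<close> may be nonpositive
because \<open>a = \<tau> b > 0\<close> at the point in question.\<close>

lemma radius_comparison:
  fixes a b :: "'a::euclidean_space \<Rightarrow> real"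
  assumes "compact T" "open S" "S \<subseteq> T"
    and ca: "continuous_on T a" and cb: "continuous_on T b"
    and bpos: "\<And>x. x \<in> T \<Longrightarrow> b x > 0"
    and "\<sigma> \<ge> 1" and bd: "\<And>x. x \<in> T - S \<Longrightarrow> a x \<le> \<sigma> * b x"
    and a: "has_grad_laplacian S a ga la" and b: "has_grad_laplacian S b gb lb"
    and sub: "\<And>x. x \<in> S \<Longrightarrow> a x > 0 \<Longrightarrow> 0 \<le> radius_defect (a x) (ga x) (la x)"
    and super: "\<And>x. x \<in> S \<Longrightarrow> radius_defect (b x) (gb x) (lb x) \<le> 0"
    and x: "x \<in> T"
  shows "a x \<le> \<sigma> * b x"
proof (rule ccontr)
  assume neg: "\<not> a x \<le> \<sigma> * b x"
  have bne: "b z \<noteq> 0" if "z \<in> T" for z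
    using bpos[OF that] by simp
  have "continuous_on T (\<lambda>x. a x / b x)"
    by (intro continuous_on_divide ca cb ballI bne)
  then have "\<exists>y\<in>T. \<forall>z\<in>T. a z / b z \<le> a y / b y"
    by (rule continuous_attains_sup[OF assms(1), rotated]) (use x in blast)
  then obtain y where y: "y \<in> T" "\<And>z. z \<in> T \<Longrightarrow> a z / b z \<le> a y / b y"
    by blast
  define \<tau> where "\<tau> = a y / b y"
  have by0: "b y > 0" using y bpos by blast
  have "\<sigma> < a x / b x" using neg bpos[OF x] by (simp add: field_simps)
  also have "\<dots> \<le> \<tau>" unfolding \<tau>_def using y x by blast
  finally have \<tau>: "\<sigma> < \<tau>" .
  have ay: "a y = \<tau> * b y" using by0 by (simp add: \<tau>_def)
  have le: "a z \<le> \<tau> * b z" if "z \<in> T" for z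
    using y(2)[OF that] bpos[OF that] by (simp add: \<tau>_def field_simps)
  have yS: "y \<in> S"
  proof (rule ccontr)
    assume "y \<notin> S"
    then have "\<tau> * b y \<le> \<sigma> * b y" using bd[of y] y ay by simp
    with \<tau> by0 show False by simp
  qed
  have m: "has_grad_laplacian S (\<lambda>x. a x + (- \<tau>) * b x) (\<lambda>x. ga x + (- \<tau>) *\<^sub>R gb x)
      (\<lambda>x. la x + (- \<tau>) * lb x)"
    by (rule has_grad_laplacian_add[OF a has_grad_laplacian_cmult[OF b]])
  have mx: "a z + (- \<tau>) * b z \<le> a y + (- \<tau>) * b y" if "z \<in> S" for z
    using le[of z] that \<open>S \<subseteq> T\<close> ay by auto
  have g: "ga y = \<tau> *\<^sub>R gb y" and l: "la y \<le> \<tau> * lb y"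
    using interior_max_grad_laplacian[OF m \<open>open S\<close> yS mx] by simp_all
  define n where "n = real DIM('a)"
  have n: "n > 0" by (simp add: n_def)
  have "a y > 0" using ay by0 \<tau> \<open>\<sigma> \<ge> 1\<close> by simp
  from sub[OF yS this] have 1: "n / 2 * (\<tau>\<^sup>2 * (gb y \<bullet> gb y) - 4) \<le> \<tau> * b y * la y"
    by (simp add: radius_defect_def n_def g ay power2_eq_square algebra_simps)
  have "\<tau> * b y * la y \<le> \<tau> * b y * (\<tau> * lb y)"
    using l \<tau> by0 \<open>\<sigma> \<ge> 1\<close> by (intro mult_left_mono) auto
  also have "\<dots> = \<tau>\<^sup>2 * (b y * lb y)" by (simp add: power2_eq_square)
  also have "\<dots> \<le> \<tau>\<^sup>2 * (n / 2 * (gb y \<bullet> gb y - 4))"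
    using super[OF yS] by (intro mult_left_mono) (auto simp: radius_defect_def n_def)
  finally have "n * (\<tau>\<^sup>2 - 1) \<le> 0" using 1 by (simp add: field_simps)
  moreover have "\<tau>\<^sup>2 > 1" using \<tau> \<open>\<sigma> \<ge> 1\<close> by (simp add: one_less_power)
  ultimately show False using n by (simp add: mult_le_0_iff)
qed

text \<open>With \<open>\<beta> = - 2 / (n - 2)\<close> the power of \<open>u\<close> in \<open>v \<Delta>v\<close> coming from the nonlinearity cancels, as
\<open>2 \<beta> - 1 + (n + 2) / (n - 2) = 0\<close>, and the gradient terms cancel because \<open>\<beta> - 1 = (n / 2) \<beta>\<close>.\<close>

lemma hyperbolic_radius_defect:
  fixes u :: "'a::euclidean_space \<Rightarrow> real"
  assumes n: "DIM('a) \<ge> 3" and u: "has_grad_laplacian S u g l"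
    and pos: "\<And>x. x \<in> S \<Longrightarrow> u x > 0"
    and eq: "\<And>x. x \<in> S \<Longrightarrow>
      l x = real DIM('a) * (real DIM('a) - 2) * u x powr ((real DIM('a) + 2) / (real DIM('a) - 2))"
  obtains g' l' where "has_grad_laplacian S (hyperbolic_radius u) g' l'"
    "\<And>x. x \<in> S \<Longrightarrow> radius_defect (hyperbolic_radius u x) (g' x) (l' x) = 0"
proof -
  define n where "n = real DIM('a)"
  have n3: "n \<ge> 3" using n by (simp add: n_def)
  define \<beta> where "\<beta> = - 2 / (n - 2)"
  define p where "p = (n + 2) / (n - 2)"
  have b1: "\<beta> - 1 = n / 2 * \<beta>" using n3 by (simp add: \<beta>_def field_simps)
  have bp: "2 * \<beta> - 1 + p = 0" using n3 by (simp add: \<beta>_def p_def field_simps)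
  have bn: "\<beta> * (n - 2) = - 2" using n3 by (simp add: \<beta>_def nonzero_divide_eq_eq)
  define g' where "g' x = (\<beta> * u x powr (\<beta> - 1)) *\<^sub>R g x" for x
  define l' where "l' x = (\<beta> * u x powr (\<beta> - 1)) * l x
     + \<beta> * ((\<beta> - 1) * u x powr (\<beta> - 2)) * (g x \<bullet> g x)" for x
  have hr: "hyperbolic_radius u = (\<lambda>x. u x powr \<beta>)"
    by (auto simp: hyperbolic_radius_def \<beta>_def n_def)
  show ?thesis
  proof (rule that)
    show "has_grad_laplacian S (hyperbolic_radius u) g' l'"
      unfolding hr g'_def l'_def
      by (rule has_grad_laplacian_compose[OF u, where \<phi>'="\<lambda>t. \<beta> * t powr (\<beta> - 1)"
          and \<phi>="\<lambda>t. t powr \<beta>" and \<phi>''="\<lambda>t. \<beta> * ((\<beta> - 1) * t powr (\<beta> - 2))"])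
         (use pos in \<open>auto intro!: derivative_eq_intros has_real_derivative_powr simp: diff_diff_eq\<close>)
    fix x assume x: "x \<in> S"
    define U where "U = u x"
    have U: "U > 0" using pos x by (simp add: U_def)
    have p1: "U powr \<beta> * U powr (\<beta> - 1) * U powr p = 1"
      using U bp by (simp add: powr_add[symmetric])
    have p2: "U powr \<beta> * U powr (\<beta> - 2) = (U powr (\<beta> - 1))\<^sup>2"
      using U by (simp add: powr_add[symmetric] powr_power power2_eq_square)
    have "radius_defect (hyperbolic_radius u x) (g' x) (l' x)
      = \<beta> * (n * (n - 2)) * (U powr \<beta> * U powr (\<beta> - 1) * U powr p)
        + \<beta> * (\<beta> - 1) * (U powr \<beta> * U powr (\<beta> - 2)) * (g x \<bullet> g x)
        - n / 2 * (\<beta>\<^sup>2 * (U powr (\<beta> - 1))\<^sup>2 * (g x \<bullet> g x) - 4)"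
      unfolding radius_defect_def hr g'_def l'_def eq[OF x] n_def[symmetric] p_def[symmetric] U_def[symmetric]
      by (simp add: algebra_simps power2_eq_square)
    also have "\<dots> = n * (\<beta> * (n - 2)) + 2 * n
       + \<beta> * (\<beta> - 1 - n / 2 * \<beta>) * (U powr (\<beta> - 1))\<^sup>2 * (g x \<bullet> g x)"
      unfolding p1 p2 by (simp add: algebra_simps power2_eq_square)
    also have "\<dots> = 0" unfolding bn b1 by simp
    finally show "radius_defect (hyperbolic_radius u x) (g' x) (l' x) = 0" .
  qed
qed

text \<open>This is the hyperbolic metric of the exterior of a ball: \<open>V = (\<bar>x - z\<bar>\<^sup>2 - \<rho>\<^sup>2) / \<rho>\<close> has
\<open>V \<Delta>V = 2 n (\<bar>x - z\<bar>\<^sup>2 - \<rho>\<^sup>2) / \<rho>\<^sup>2 = (n / 2) (\<bar>\<nabla>V\<bar>\<^sup>2 - 4)\<close>. The mixed second derivatives are computed as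
well, since a classical solution must be of class \<open>C\<^sup>2\<close>.\<close>

lemma exterior_ball_solution:
  fixes \<Omega> :: "'a::euclidean_space set"
  assumes n: "DIM('a) \<ge> 3" and "open \<Omega>" and \<rho>: "\<rho> > 0"
    and out: "\<And>x. x \<in> \<Omega> \<Longrightarrow> \<rho> < dist x z"
  shows "classical_solution \<Omega>
    (\<lambda>x. (((dist x z)\<^sup>2 - \<rho>\<^sup>2) / \<rho>) powr (- (real DIM('a) - 2) / 2))"
proof -
  define n where "n = real DIM('a)"
  have n3: "n \<ge> 3" using n by (simp add: n_def)
  define \<gamma> where "\<gamma> = - (n - 2) / 2"
  define V where "V x = ((x - z) \<bullet> (x - z) - \<rho>\<^sup>2) / \<rho>" for x
  define f where "f x = V x powr \<gamma>" for x
  have fdef: "(\<lambda>x. (((dist x z)\<^sup>2 - \<rho>\<^sup>2) / \<rho>) powr (- (real DIM('a) - 2) / 2)) = f"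
    by (auto simp: f_def V_def \<gamma>_def n_def dist_norm power2_norm_eq_inner)
  have Vpos: "V x > 0" if "x \<in> \<Omega>" for x
  proof -
    have "\<rho>\<^sup>2 < (dist x z)\<^sup>2" using out[OF that] \<rho> by (intro power_strict_mono) auto
    then show ?thesis using \<rho> by (simp add: V_def dist_norm power2_norm_eq_inner)
  qed
  have dV: "(V has_derivative (\<lambda>h. (2 / \<rho>) * ((x - z) \<bullet> h))) (at x)" for x
    unfolding V_def using \<rho>
    by (auto intro!: derivative_eq_intros simp: inner_commute field_simps)
  have dpow: "((\<lambda>x. c * V x powr s) has_derivative
      (\<lambda>h. c * (s * V x powr (s - 1)) * ((2 / \<rho>) * ((x - z) \<bullet> h)))) (at x)" if "x \<in> \<Omega>" for x c s
  proof -
    have "((\<lambda>t. c * t powr s) has_real_derivative c * (s * V x powr (s - 1))) (at (V x))"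
      using Vpos[OF that] by (auto intro!: derivative_eq_intros has_real_derivative_powr)
    then have "((\<lambda>t. c * t powr s) has_derivative (*) (c * (s * V x powr (s - 1)))) (at (V x))"
      by (simp add: has_field_derivative_def)
    from has_derivative_compose[OF dV this] show ?thesis .
  qed
  define p where "p i x = \<gamma> * V x powr (\<gamma> - 1) * ((2 / \<rho>) * ((x - z) \<bullet> i))" for i x
  have df: "(f has_derivative (\<lambda>h. \<gamma> * V x powr (\<gamma> - 1) * ((2 / \<rho>) * ((x - z) \<bullet> h)))) (at x)"
    if "x \<in> \<Omega>" for x
    using dpow[OF that, of 1 \<gamma>] by (simp add: f_def[abs_def])
  have pf: "pderiv_dir i f x = p i x" if "x \<in> \<Omega>" for x i
    unfolding pderiv_dir_def frechet_derivative_at[OF df[OF that], symmetric] p_def ..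
  define q where "q i j x = \<gamma> * V x powr (\<gamma> - 1) * ((2 / \<rho>) * (j \<bullet> i))
      + \<gamma> * ((\<gamma> - 1) * V x powr (\<gamma> - 2)) * ((2 / \<rho>) * ((x - z) \<bullet> j)) * ((2 / \<rho>) * ((x - z) \<bullet> i))" for i j x
  have dp: "(pderiv_dir i f has_derivative (\<lambda>h. q i h x)) (at x)" if x: "x \<in> \<Omega>" for x i
  proof -
    have "((\<lambda>x. (2 / \<rho>) * ((x - z) \<bullet> i)) has_derivative (\<lambda>h. (2 / \<rho>) * (h \<bullet> i))) (at x)"
      using \<rho> by (auto intro!: derivative_eq_intros)
    from has_derivative_mult[OF dpow[OF x, of \<gamma> "\<gamma> - 1"] this]
    have "(p i has_derivative (\<lambda>h. q i h x)) (at x)"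
      by (simp add: p_def[abs_def] q_def diff_diff_eq)
    then show ?thesis
      by (rule has_derivative_transform_within_open[OF _ \<open>open \<Omega>\<close> x]) (simp add: pf)
  qed
  have pp: "pderiv_dir j (pderiv_dir i f) x = q i j x" if "x \<in> \<Omega>" for x i j
    unfolding pderiv_dir_def[of j "pderiv_dir i f"] frechet_derivative_at[OF dp[OF that], symmetric] ..
  have cV: "continuous_on \<Omega> V" using \<rho> by (auto simp: V_def intro!: continuous_intros)
  have "continuous_on \<Omega> (q i j)" for i j
    unfolding q_def[abs_def] by (intro continuous_intros cV) (use Vpos in force)+
  then have "continuous_on \<Omega> (pderiv_dir j (pderiv_dir i f))" for i j
    by (rule continuous_on_eq) (simp add: pp)
  moreover have "f differentiable (at x)" "pderiv_dir i f differentiable (at x)" if "x \<in> \<Omega>" for x i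
    using df dp that by (auto simp: differentiable_def)
  ultimately have C2: "Ck_on 2 \<Omega> f" by (simp add: numeral_2_eq_2)
  have "- laplacian f x + n * (n - 2) * f x powr ((n + 2) / (n - 2)) = 0" if x: "x \<in> \<Omega>" for x
  proof -
    note V = Vpos[OF x]
    define D where "D = (x - z) \<bullet> (x - z)"
    have "laplacian f x = (\<Sum>i\<in>Basis. q i i x)"
      by (simp add: laplacian_def pp x)
    also have "\<dots> = \<gamma> * V x powr (\<gamma> - 1) * (2 / \<rho>) * n
       + \<gamma> * ((\<gamma> - 1) * V x powr (\<gamma> - 2)) * (2 / \<rho>)\<^sup>2 * D"
    proof -
      have "q i i x = \<gamma> * V x powr (\<gamma> - 1) * (2 / \<rho>)
          + \<gamma> * ((\<gamma> - 1) * V x powr (\<gamma> - 2)) * (2 / \<rho>)\<^sup>2 * (((x - z) \<bullet> i) * ((x - z) \<bullet> i))"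
        if "i \<in> Basis" for i
        using that unfolding q_def by (simp add: power2_eq_square)
      then have "(\<Sum>i\<in>Basis. q i i x) = (\<Sum>i\<in>(Basis :: 'a set). \<gamma> * V x powr (\<gamma> - 1) * (2 / \<rho>)
          + \<gamma> * ((\<gamma> - 1) * V x powr (\<gamma> - 2)) * (2 / \<rho>)\<^sup>2 * (((x - z) \<bullet> i) * ((x - z) \<bullet> i)))"
        by (rule sum.cong[OF refl])
      also have "\<dots> = \<gamma> * V x powr (\<gamma> - 1) * (2 / \<rho>) * n
          + \<gamma> * ((\<gamma> - 1) * V x powr (\<gamma> - 2)) * (2 / \<rho>)\<^sup>2 * D"
        unfolding sum.distrib sum_distrib_left[symmetric] D_def euclidean_inner[of "x - z" "x - z"]
        by (simp add: n_def)
      finally show ?thesis .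
    qed
    also have "V x powr (\<gamma> - 1) = V x powr (\<gamma> - 2) * V x"
      using V powr_add[of "V x" "\<gamma> - 2" 1] by simp
    also have "\<gamma> * (V x powr (\<gamma> - 2) * V x) * (2 / \<rho>) * n
       + \<gamma> * ((\<gamma> - 1) * V x powr (\<gamma> - 2)) * (2 / \<rho>)\<^sup>2 * D
       = \<gamma> * V x powr (\<gamma> - 2) * (2 * n * V x / \<rho> + (\<gamma> - 1) * 4 * D / \<rho>\<^sup>2)"
      by (simp add: power2_eq_square algebra_simps add_divide_distrib diff_divide_distrib)
    also have "2 * n * V x / \<rho> + (\<gamma> - 1) * 4 * D / \<rho>\<^sup>2 = - 2 * n"
      using \<rho> unfolding V_def D_def[symmetric] \<gamma>_def by (simp add: power2_eq_square field_simps)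
    also have "\<gamma> * V x powr (\<gamma> - 2) * (- 2 * n) = n * (n - 2) * V x powr (\<gamma> - 2)"
    proof -
      have "\<gamma> * (- 2 * n) = n * (n - 2)" by (simp add: \<gamma>_def field_simps)
      then have "\<gamma> * (- 2 * n) * V x powr (\<gamma> - 2) = n * (n - 2) * V x powr (\<gamma> - 2)" by simp
      then show ?thesis by (simp only: mult_ac)
    qed
    also have "V x powr (\<gamma> - 2) = f x powr ((n + 2) / (n - 2))"
    proof -
      have "\<gamma> - 2 = \<gamma> * ((n + 2) / (n - 2))"
        using n3 by (simp add: \<gamma>_def field_simps)
      then show ?thesis unfolding f_def by (simp add: powr_powr)
    qed
    finally show ?thesis by simp
  qed
  moreover have "f x > 0" if "x \<in> \<Omega>" for x using Vpos[OF that] by (simp add: f_def)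
  ultimately have "classical_solution \<Omega> f"
    unfolding classical_solution_def Let_def n_def[symmetric] using C2 by simp
  then show ?thesis unfolding fdef .
qed

text \<open>The negative exponent reverses the order: a lower bound for the maximal solution is an
upper bound for its radius.\<close>

lemma maximal_radius_le:
  fixes \<Omega> :: "'a::euclidean_space set"
  assumes n: "DIM('a) \<ge> 3" and "open \<Omega>" and \<rho>: "\<rho> > 0" and max: "maximal_solution \<Omega> u"
    and out: "\<And>x. x \<in> \<Omega> \<Longrightarrow> \<rho> < dist x z" and x: "x \<in> \<Omega>"
  shows "hyperbolic_radius u x \<le> ((dist x z)\<^sup>2 - \<rho>\<^sup>2) / \<rho>"
proof -
  define n where "n = real DIM('a)"
  have n3: "n \<ge> 3" using n by (simp add: n_def)
  define V where "V = ((dist x z)\<^sup>2 - \<rho>\<^sup>2) / \<rho>"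
  have "\<rho>\<^sup>2 < (dist x z)\<^sup>2" using out[OF x] \<rho> by (intro power_strict_mono) auto
  then have V: "V > 0" using \<rho> by (simp add: V_def)
  have le: "V powr (- (n - 2) / 2) \<le> u x"
    using max exterior_ball_solution[OF n \<open>open \<Omega>\<close> \<rho> out] x
    unfolding maximal_solution_def V_def n_def by blast
  have "hyperbolic_radius u x = u x powr (- 2 / (n - 2))"
    by (simp add: hyperbolic_radius_def n_def)
  also have "\<dots> \<le> (V powr (- (n - 2) / 2)) powr (- 2 / (n - 2))"
    by (rule powr_mono2') (use le n3 V in auto)
  also have "\<dots> = V"
  proof -
    have "- (n - 2) / 2 * (- 2 / (n - 2)) = 1" using n3 by (simp add: divide_simps)
    then show ?thesis using V by (simp only: powr_powr powr_one)
  qed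
  finally show ?thesis by (simp add: V_def)
qed

section \<open>Exterior balls and the vanishing of the radius at the boundary\<close>

lemma extends_continuously_bounded:
  fixes f :: "'a::euclidean_space \<Rightarrow> 'b::real_normed_vector"
  assumes "bounded U" "extends_continuously U f"
  obtains C where "C > 0" "\<And>x. x \<in> U \<Longrightarrow> norm (f x) \<le> C"
proof -
  obtain g where g: "continuous_on (closure U) g" "\<And>x. x \<in> U \<Longrightarrow> g x = f x"
    using assms(2) unfolding extends_continuously_def by blast
  have "compact (closure U)" using assms(1) by simp
  then have "bounded (g ` closure U)"
    using g(1) by (intro compact_imp_bounded compact_continuous_image)
  then obtain C where "C > 0" "\<And>x. x \<in> closure U \<Longrightarrow> norm (g x) \<le> C"
    by (auto simp: bounded_pos)
  then show ?thesis using that g(2) closure_subset by (metis subsetD)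
qed

lemma bounded_pderiv_imp_lipschitz:
  fixes f :: "'a::euclidean_space \<Rightarrow> 'b::real_normed_vector"
  assumes "bounded U" "convex U" "holder_derivs (Suc k) \<alpha> U f" "open U"
  obtains L where "L > 0" "\<And>x y. x \<in> U \<Longrightarrow> y \<in> U \<Longrightarrow> norm (f x - f y) \<le> L * dist x y"
proof -
  have ext: "extends_continuously U (pderiv_dir i f)" if "i \<in> Basis" for i
    using assms(3) that by (cases k) auto
  have diff: "f differentiable (at x)" if "x \<in> U" for x
    using assms(3) that by auto
  have "\<forall>i\<in>Basis. \<exists>C>0. \<forall>x\<in>U. norm (pderiv_dir i f x) \<le> C"
    using extends_continuously_bounded[OF assms(1) ext] by metis
  then obtain C where C: "\<And>i. i \<in> Basis \<Longrightarrow> C i > 0"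
    "\<And>i x. i \<in> Basis \<Longrightarrow> x \<in> U \<Longrightarrow> norm (pderiv_dir i f x) \<le> C i"
    by metis
  define L where "L = (\<Sum>i\<in>(Basis::'a set). C i)"
  have "L > 0" unfolding L_def by (intro sum_pos C) auto
  have on: "onorm (frechet_derivative f (at x)) \<le> L" if x: "x \<in> U" for x
  proof (rule onorm_le)
    fix h :: 'a
    have lin: "linear (frechet_derivative f (at x))"
      using diff[OF x] frechet_derivative_works has_derivative_linear by blast
    have "frechet_derivative f (at x) h = frechet_derivative f (at x) (\<Sum>i\<in>Basis. (h \<bullet> i) *\<^sub>R i)"
      by (simp add: euclidean_representation)
    also have "\<dots> = (\<Sum>i\<in>Basis. (h \<bullet> i) *\<^sub>R pderiv_dir i f x)"
      by (simp add: linear_sum[OF lin] linear_cmul[OF lin] pderiv_dir_def)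
    also have "norm \<dots> \<le> (\<Sum>i\<in>Basis. norm h * C i)"
      by (rule sum_norm_le) (auto intro!: mult_mono Basis_le_norm C x)
    also have "\<dots> = L * norm h" using sum_distrib_left[of "norm h" C Basis] by (simp add: L_def mult.commute)
    finally show "norm (frechet_derivative f (at x) h) \<le> L * norm h" .
  qed
  show ?thesis
  proof (rule that[OF \<open>L > 0\<close>])
    fix x y assume "x \<in> U" "y \<in> U"
    then show "norm (f x - f y) \<le> L * dist x y"
      unfolding dist_norm
      by (rule differentiable_bound[OF assms(2) _ on, rotated 2])
         (use diff frechet_derivative_works has_derivative_at_withinI in blast)+
  qed
qed

text \<open>A chart takes the exterior side of the boundary to the half space below a hyperplane. There, the ball
of radius \<open>t\<close> about the point at depth \<open>t\<close> stays on the exterior side. The chart and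
its inverse are Lipschitz near \<open>p\<close>, so that this ball contains the image of a ball of comparable radius,
whose centre is at a distance of order \<open>t\<close> from \<open>p\<close>. The balls need not touch the boundary.\<close>

lemma exterior_corkscrew:
  fixes \<Omega> :: "'a::euclidean_space set"
  assumes "holder_domain 2 \<alpha> \<Omega>" "p \<in> frontier \<Omega>"
  obtains c r where "c > 0" "r > 0"
    "\<And>\<rho>. 0 < \<rho> \<Longrightarrow> \<rho> < r \<Longrightarrow> \<exists>z. dist z p \<le> c * \<rho> \<and> ball z \<rho> \<inter> \<Omega> = {}"
proof -
  obtain r D \<psi> \<phi> e where r: "r > 0" and e: "e \<in> Basis" and
    dif: "holder_diffeo 2 \<alpha> (ball p r) D \<psi> \<phi>" and
    im: "\<psi> ` (ball p r \<inter> \<Omega>) = D \<inter> {y. y \<bullet> e > 0}" and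
    fr: "\<psi> ` (ball p r \<inter> frontier \<Omega>) = D \<inter> {y. y \<bullet> e = 0}"
    using assms unfolding holder_domain_def by metis
  have D: "open D" and hom: "homeomorphism (ball p r) D \<psi> \<phi>"
    and h\<psi>: "holder_derivs (Suc 1) \<alpha> (ball p r) \<psi>" and h\<phi>: "holder_derivs (Suc 1) \<alpha> D \<phi>"
    using dif unfolding holder_diffeo_def holder_space_def by (auto simp: numeral_2_eq_2)
  obtain L where L: "L > 0" "\<And>x y. x \<in> ball p r \<Longrightarrow> y \<in> ball p r \<Longrightarrow> norm (\<psi> x - \<psi> y) \<le> L * dist x y"
    using bounded_pderiv_imp_lipschitz[OF bounded_ball convex_ball h\<psi> open_ball] by metis
  define q where "q = \<psi> p"
  have p: "p \<in> ball p r" using r by simp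
  then have qD: "q \<in> D" and \<phi>q: "\<phi> q = p"
    using hom unfolding q_def homeomorphism_def by auto
  have qe: "q \<bullet> e = 0" using fr p assms(2) unfolding q_def by blast
  obtain s where s: "s > 0" "ball q s \<subseteq> D" using D qD by (meson openE)
  have "\<phi> differentiable (at q)" using h\<phi> qD by auto
  then obtain \<phi>' where \<phi>': "(\<phi> has_derivative \<phi>') (at q)" by (auto simp: differentiable_def)
  \<comment> \<open>The centre of the ball is compared with \<open>p = \<phi> q\<close> only, so differentiability of \<open>\<phi>\<close> at \<open>q\<close> gives this bound.\<close>
  obtain M t0 where M: "M > 0" "t0 > 0" "\<And>y. dist y q < t0 \<Longrightarrow> dist (\<phi> y) p \<le> M * dist y q"
  proof -
    obtain K where K: "K > 0" "\<And>h. norm (\<phi>' h) \<le> norm h * K"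
      using bounded_linear.pos_bounded[OF has_derivative_bounded_linear[OF \<phi>']] by blast
    obtain t0 where t0: "t0 > 0"
      "\<And>y. norm (y - q) < t0 \<Longrightarrow> norm (\<phi> y - \<phi> q - \<phi>' (y - q)) \<le> 1 * norm (y - q)"
      using \<phi>' unfolding has_derivative_within_alt by (metis UNIV_I zero_less_one)
    show ?thesis
    proof (rule that)
      show "K + 1 > 0" "t0 > 0" using K t0 by auto
      fix y assume "dist y q < t0"
      then have "norm (\<phi> y - \<phi> q - \<phi>' (y - q)) \<le> norm (y - q)" using t0(2)[of y] by (simp add: dist_norm)
      moreover have "norm (\<phi> y - \<phi> q) \<le> norm (\<phi> y - \<phi> q - \<phi>' (y - q)) + norm (\<phi>' (y - q))"
        using norm_triangle_ineq[of "\<phi> y - \<phi> q - \<phi>' (y - q)" "\<phi>' (y - q)"] by simp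
      ultimately show "dist (\<phi> y) p \<le> (K + 1) * dist y q"
        using K(2)[of "y - q"] by (simp add: dist_norm \<phi>q algebra_simps)
    qed
  qed
  define c where "c = M * L"
  \<comment> \<open>For \<open>\<rho> < R\<close> the depth \<open>t = L \<rho>\<close> is below \<open>t0\<close> and \<open>s\<close>, and the ball of radius \<open>\<rho>\<close> about the
    centre \<open>z\<close>, with \<open>dist z p \<le> M t\<close>, remains in the domain of the chart.\<close>
  define R where "R = min (min (t0 / L) (s / L)) (r / (2 * (M * L + 1)))"
  have cpos: "M * L > 0" using M L by simp
  show ?thesis
  proof (rule that)
    show "c > 0" using cpos by (simp add: c_def)
    have "2 * (M * L + 1) > 0"
      by (rule mult_pos_pos[OF zero_less_numeral add_pos_pos[OF cpos zero_less_one]])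
    with M(2) L(1) s(1) r show "R > 0"
      unfolding R_def min_less_iff_conj by (intro conjI divide_pos_pos)
    fix \<rho> assume \<rho>: "0 < \<rho>" "\<rho> < R"
    define t where "t = L * \<rho>"
    have t: "0 < t" "t < t0" "t < s" using \<rho> L by (auto simp: t_def R_def field_simps)
    define y where "y = q - t *\<^sub>R e"
    have dy: "dist y q = t" using t e by (simp add: y_def dist_norm)
    define z where "z = \<phi> y"
    have yD: "y \<in> D" using s t dy by (auto simp: dist_commute subset_iff)
    have zp: "dist z p \<le> M * t" using M(3)[of y] dy t by (simp add: z_def)
    have "(M * L + 1) * \<rho> < r / 2"
      using \<rho> mult_pos_pos[OF M(1) L(1)] by (simp add: R_def field_simps)
    then have rr: "M * t + \<rho> < r" using r by (simp add: t_def algebra_simps)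
    have \<psi>z: "\<psi> z = y" using hom yD unfolding z_def homeomorphism_def by auto
    have "ball z \<rho> \<inter> \<Omega> = {}"
    proof (rule ccontr)
      assume "ball z \<rho> \<inter> \<Omega> \<noteq> {}"
      then obtain x where x: "dist x z < \<rho>" "x \<in> \<Omega>" by (auto simp: dist_commute)
      have zB: "z \<in> ball p r" using zp rr \<rho> by (simp add: dist_commute)
      have xB: "x \<in> ball p r"
        using dist_triangle[of x p z] x zp rr by (simp add: dist_commute)
      have "norm (\<psi> x - y) \<le> L * dist x z" using L(2)[OF xB zB] \<psi>z by simp
      also have "\<dots> < t" using x L by (simp add: t_def)
      finally have "\<bar>(\<psi> x - y) \<bullet> e\<bar> < t" using Basis_le_norm[OF e, of "\<psi> x - y"] by linarith
      then have "\<psi> x \<bullet> e < y \<bullet> e + t" by (simp add: inner_diff_left)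
      also have "\<dots> = 0" using e qe by (simp add: y_def inner_diff_left)
      finally have "\<psi> x \<bullet> e < 0" .
      moreover have "\<psi> x \<bullet> e > 0" using im xB x(2) by blast
      ultimately show False by simp
    qed
    then show "\<exists>z. dist z p \<le> c * \<rho> \<and> ball z \<rho> \<inter> \<Omega> = {}"
      using zp by (auto simp: c_def t_def mult.assoc)
  qed
qed

text \<open>For \<open>x\<close> within \<open>\<rho>\<close> of \<open>p\<close> and an exterior ball of radius \<open>\<rho>\<close> with centre within \<open>c \<rho>\<close> of \<open>p\<close>, the explicit
bound is of order \<open>(c + 1)\<^sup>2 \<rho>\<close>. The concentric ball of half the radius is used to have its closure
outside \<open>\<Omega>\<close>, as positivity of the explicit solution requires.\<close>

lemma hyperbolic_radius_small_at_frontier: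
  fixes \<Omega> :: "'a::euclidean_space set"
  assumes n: "DIM('a) \<ge> 3" and dom: "holder_domain 2 \<alpha> \<Omega>" and max: "maximal_solution \<Omega> u"
    and p: "p \<in> frontier \<Omega>" and "\<epsilon> > 0"
  shows "\<exists>r>0. \<forall>x\<in>\<Omega> \<inter> ball p r. hyperbolic_radius u x \<le> \<epsilon>"
proof -
  obtain c r where c: "c > 0" "r > 0"
    "\<And>\<rho>. 0 < \<rho> \<Longrightarrow> \<rho> < r \<Longrightarrow> \<exists>z. dist z p \<le> c * \<rho> \<and> ball z \<rho> \<inter> \<Omega> = {}"
    using exterior_corkscrew[OF dom p] by metis
  define \<rho> where "\<rho> = min (r / 2) (\<epsilon> / (2 * (c + 1)\<^sup>2))"
  have \<rho>: "0 < \<rho>" "\<rho> < r" "2 * (c + 1)\<^sup>2 * \<rho> \<le> \<epsilon>"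
    using c \<open>\<epsilon> > 0\<close> by (auto simp: \<rho>_def min_def field_simps)
  obtain z where z: "dist z p \<le> c * \<rho>" "ball z \<rho> \<inter> \<Omega> = {}" using c(3) \<rho> by blast
  have out: "\<rho> / 2 < dist x z" if "x \<in> \<Omega>" for x
  proof -
    have "x \<notin> ball z \<rho>" using z that by blast
    then show ?thesis using \<rho> by (simp add: dist_commute)
  qed
  have op: "open \<Omega>" using dom by (simp add: holder_domain_def)
  show ?thesis
  proof (intro exI[of _ \<rho>] conjI ballI)
    fix x assume x: "x \<in> \<Omega> \<inter> ball p \<rho>"
    have "dist x z \<le> (c + 1) * \<rho>"
      using x z dist_triangle[of x z p] by (simp add: dist_commute algebra_simps)
    then have "(dist x z)\<^sup>2 \<le> ((c + 1) * \<rho>)\<^sup>2" by (intro power_mono) auto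
    have "hyperbolic_radius u x \<le> ((dist x z)\<^sup>2 - (\<rho> / 2)\<^sup>2) / (\<rho> / 2)"
      by (rule maximal_radius_le[OF n op _ max out]) (use \<rho> x in auto)
    also have "\<dots> \<le> ((c + 1) * \<rho>)\<^sup>2 / (\<rho> / 2)"
      using \<open>(dist x z)\<^sup>2 \<le> ((c + 1) * \<rho>)\<^sup>2\<close> \<rho> zero_le_power2[of "\<rho> / 2"]
      by (intro divide_right_mono) linarith+
    also have "\<dots> = 2 * (c + 1)\<^sup>2 * \<rho>" using \<rho> by (simp add: power2_eq_square)
    also have "\<dots> \<le> \<epsilon>" by fact
    finally show "hyperbolic_radius u x \<le> \<epsilon>" .
  qed (use \<rho> in auto)
qed

lemma bdist_attained:
  assumes "0 < bdist \<Omega> x"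
  obtains y where "y \<in> frontier \<Omega>" "bdist \<Omega> x = dist x y"
proof -
  have "frontier \<Omega> \<noteq> {}" using assms by (auto simp: bdist_def infdist_def)
  then show ?thesis
    using infdist_attains_inf[OF frontier_closed, of \<Omega> x] that unfolding bdist_def by metis
qed

text \<open>The neighbourhoods of the previous lemma cover the compact boundary, and a Lebesgue number of this
cover is a width that works along the whole boundary.\<close>

lemma hyperbolic_radius_vanishes:
  fixes \<Omega> :: "'a::euclidean_space set"
  assumes n: "DIM('a) \<ge> 3" and dom: "holder_domain 2 \<alpha> \<Omega>" and max: "maximal_solution \<Omega> u"
    and bdd: "bounded \<Omega>" and "\<epsilon> > 0"
  obtains \<eta> where "\<eta> > 0" "\<And>x. x \<in> strip \<Omega> \<eta> \<Longrightarrow> hyperbolic_radius u x \<le> \<epsilon>"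
proof -
  obtain r where r: "\<And>p. p \<in> frontier \<Omega> \<Longrightarrow> r p > 0"
    "\<And>p x. p \<in> frontier \<Omega> \<Longrightarrow> x \<in> \<Omega> \<inter> ball p (r p) \<Longrightarrow> hyperbolic_radius u x \<le> \<epsilon>"
    using hyperbolic_radius_small_at_frontier[OF n dom max _ \<open>\<epsilon> > 0\<close>] by metis
  have "compact (frontier \<Omega>)" using bdd by (rule compact_frontier_bounded)
  moreover have "frontier \<Omega> \<subseteq> \<Union> ((\<lambda>p. ball p (r p)) ` frontier \<Omega>)" using r(1) by force
  ultimately obtain \<eta> where \<eta>: "\<eta> > 0"
    "\<And>y. y \<in> frontier \<Omega> \<Longrightarrow> \<exists>G\<in>(\<lambda>p. ball p (r p)) ` frontier \<Omega>. ball y \<eta> \<subseteq> G"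
    by (rule Heine_Borel_lemma) (use that in auto)
  show ?thesis
  proof (rule that[OF \<eta>(1)])
    fix x assume "x \<in> strip \<Omega> \<eta>"
    then have x: "x \<in> \<Omega>" "0 < bdist \<Omega> x" "bdist \<Omega> x < \<eta>" by (auto simp: strip_def)
    obtain y where y: "y \<in> frontier \<Omega>" "bdist \<Omega> x = dist x y" using bdist_attained x(2) by metis
    obtain p where "p \<in> frontier \<Omega>" "ball y \<eta> \<subseteq> ball p (r p)" using \<eta>(2)[OF y(1)] by blast
    moreover have "x \<in> ball y \<eta>" using x y by (simp add: dist_commute)
    ultimately show "hyperbolic_radius u x \<le> \<epsilon>" using r(2) x(1) by blast
  qed
qed

section \<open>The distance function as a coordinate near the boundary\<close>

lemma bdist_lipschitz: "\<bar>bdist \<Omega> x - bdist \<Omega> y\<bar> \<le> dist x y"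
  unfolding bdist_def
  using infdist_triangle[of x "frontier \<Omega>" y] infdist_triangle[of y "frontier \<Omega>" x]
  by (simp add: dist_commute abs_le_iff)

lemma continuous_on_bdist: "continuous_on S (bdist \<Omega>)"
  unfolding bdist_def[abs_def] by (intro continuous_intros)

text \<open>The distance decreases at unit speed along the segment to a nearest boundary point, and it is
Lipschitz with constant \<open>1\<close>. So the gradient has a component of modulus \<open>1\<close> and norm at most \<open>1\<close>.\<close>

lemma norm_gradient_bdist:
  fixes \<Omega> :: "'a::euclidean_space set"
  assumes D: "(bdist \<Omega> has_derivative (\<lambda>h. g \<bullet> h)) (at x)" and x: "0 < bdist \<Omega> x"
  shows "g \<bullet> g = 1"
proof -
  obtain y where y: "y \<in> frontier \<Omega>" "bdist \<Omega> x = dist x y" using bdist_attained x by metis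
  define \<nu> where "\<nu> = (1 / norm (y - x)) *\<^sub>R (y - x)"
  have nz: "norm (y - x) > 0" using x y by (simp add: dist_norm norm_minus_commute)
  have n1: "norm \<nu> = 1" using nz by (simp add: \<nu>_def)
  define R where "R = norm (y - x)"
  have line: "bdist \<Omega> (x + t *\<^sub>R \<nu>) = R - t" if "0 \<le> t" "t \<le> R" for t
  proof -
    have "bdist \<Omega> (x + t *\<^sub>R \<nu>) \<le> dist (x + t *\<^sub>R \<nu>) y"
      unfolding bdist_def by (rule infdist_le[OF y(1)])
    also have "y = x + R *\<^sub>R \<nu>" using nz by (simp add: R_def \<nu>_def)
    also have "dist (x + t *\<^sub>R \<nu>) (x + R *\<^sub>R \<nu>) = R - t"
      using that n1 by (simp add: dist_norm scaleR_diff_left[symmetric])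
    finally have "bdist \<Omega> (x + t *\<^sub>R \<nu>) \<le> R - t" .
    moreover have "R - t \<le> bdist \<Omega> (x + t *\<^sub>R \<nu>)"
      using bdist_lipschitz[of \<Omega> x "x + t *\<^sub>R \<nu>"] that n1 y(2)
      by (simp add: dist_norm R_def norm_minus_commute)
    ultimately show ?thesis by simp
  qed
  have dir: "((\<lambda>t. bdist \<Omega> (x + t *\<^sub>R v)) has_real_derivative (g \<bullet> v)) (at 0)" for v
  proof -
    have "((\<lambda>t. x + t *\<^sub>R v) has_derivative (\<lambda>t. t *\<^sub>R v)) (at 0)"
      by (auto intro!: derivative_eq_intros)
    then have "((\<lambda>t. bdist \<Omega> (x + t *\<^sub>R v)) has_derivative (\<lambda>t. g \<bullet> (t *\<^sub>R v))) (at 0)"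
      by (rule has_derivative_compose) (simp add: D)
    then show ?thesis unfolding has_field_derivative_def by (simp add: mult_commute_abs)
  qed
  have lim: "((\<lambda>t. (bdist \<Omega> (x + t *\<^sub>R v) - bdist \<Omega> x) / t) \<longlongrightarrow> g \<bullet> v) (at_right 0)" for v
  proof -
    have "((\<lambda>t. (bdist \<Omega> (x + t *\<^sub>R v) - bdist \<Omega> x) / t) \<longlongrightarrow> g \<bullet> v) (at 0)"
      using dir[of v] unfolding DERIV_def by simp
    then show ?thesis by (rule tendsto_mono[rotated]) (simp add: at_le)
  qed
  have R: "R > 0" using nz by (simp add: R_def)
  have "eventually (\<lambda>t::real. t \<in> {0<..<R}) (at_right 0)"
    using R by (rule eventually_at_rightI[rotated]) auto
  then have "eventually (\<lambda>t. (bdist \<Omega> (x + t *\<^sub>R \<nu>) - bdist \<Omega> x) / t = -1) (at_right 0)"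
    using line line[of 0] R by (auto elim!: eventually_mono)
  then have "((\<lambda>t. (bdist \<Omega> (x + t *\<^sub>R \<nu>) - bdist \<Omega> x) / t) \<longlongrightarrow> -1) (at_right 0)"
    by (rule tendsto_eventually)
  from tendsto_unique[OF _ lim this] have g\<nu>: "g \<bullet> \<nu> = -1" by simp
  have "g \<bullet> g \<le> norm g"
  proof (rule tendsto_upperbound[OF lim[of g]])
    show "eventually (\<lambda>t. (bdist \<Omega> (x + t *\<^sub>R g) - bdist \<Omega> x) / t \<le> norm g) (at_right 0)"
    proof (rule eventually_at_rightI[of 0 1])
      fix t :: real assume t: "t \<in> {0<..<1}"
      have "bdist \<Omega> (x + t *\<^sub>R g) - bdist \<Omega> x \<le> t * norm g"
        using bdist_lipschitz[of \<Omega> "x + t *\<^sub>R g" x] t by (simp add: dist_norm)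
      then show "(bdist \<Omega> (x + t *\<^sub>R g) - bdist \<Omega> x) / t \<le> norm g"
        using t by (simp add: field_simps)
    qed simp
  qed simp
  then have "norm g * norm g \<le> norm g" by (simp add: dot_square_norm power2_eq_square)
  then have "norm g \<le> 1"
    using mult_strict_left_mono[of 1 "norm g" "norm g"] by fastforce
  moreover have "1 \<le> norm g"
    using Cauchy_Schwarz_ineq2[of g \<nu>] g\<nu> n1 by simp
  ultimately have "norm g = 1" by simp
  then show ?thesis by (simp add: dot_square_norm)
qed

section \<open>Barriers in terms of the distance\<close>

lemma open_strip: "open \<Omega> \<Longrightarrow> open (strip \<Omega> \<delta>)"
proof -
  assume "open \<Omega>"
  moreover have "open {x. 0 < bdist \<Omega> x}" "open {x. bdist \<Omega> x < \<delta>}"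
    by (auto intro!: open_Collect_less continuous_on_bdist)
  moreover have "strip \<Omega> \<delta> = \<Omega> \<inter> {x. 0 < bdist \<Omega> x} \<inter> {x. bdist \<Omega> x < \<delta>}"
    by (auto simp: strip_def)
  ultimately show ?thesis by (auto intro: open_Int)
qed

lemma compact_shell:
  assumes "bounded \<Omega>" "open \<Omega>" "0 < \<eta>"
  shows "compact {x \<in> \<Omega>. \<eta> \<le> bdist \<Omega> x \<and> bdist \<Omega> x \<le> r}"
proof -
  have "{x \<in> \<Omega>. \<eta> \<le> bdist \<Omega> x \<and> bdist \<Omega> x \<le> r}
    = closure \<Omega> \<inter> {x. \<eta> \<le> bdist \<Omega> x} \<inter> {x. bdist \<Omega> x \<le> r}" (is "_ = ?R")
  proof -
    have "x \<in> \<Omega>" if "x \<in> closure \<Omega>" "\<eta> \<le> bdist \<Omega> x" for x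
    proof (rule ccontr)
      assume "x \<notin> \<Omega>"
      then have "x \<in> frontier \<Omega>" using that assms(2) by (simp add: frontier_def interior_open)
      then have "bdist \<Omega> x = 0" by (simp add: bdist_def)
      with that assms(3) show False by simp
    qed
    then show ?thesis using closure_subset by fastforce
  qed
  moreover have "closed ?R"
    by (intro closed_Int closed_closure closed_Collect_le continuous_intros continuous_on_bdist)
  moreover have "bounded ?R" using assms(1) by (auto intro: bounded_subset[of "closure \<Omega>"])
  ultimately show ?thesis by (simp add: compact_eq_bounded_closed)
qed

text \<open>The comparison principle is applied away from the boundary, where all functions are continuous; the
behaviour at the boundary enters through the level set at distance \<open>\<eta>\<close>, with \<open>\<eta>\<close> small.\<close>

lemma shell_comparison:
  fixes a b :: "'a::euclidean_space \<Rightarrow> real"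
  assumes "bounded \<Omega>" "open \<Omega>" "0 < \<eta>" "r < \<delta>"
    and a: "has_grad_laplacian (strip \<Omega> \<delta>) a ga la" and b: "has_grad_laplacian (strip \<Omega> \<delta>) b gb lb"
    and bpos: "\<And>x. x \<in> \<Omega> \<Longrightarrow> \<eta> \<le> bdist \<Omega> x \<Longrightarrow> bdist \<Omega> x \<le> r \<Longrightarrow> b x > 0"
    and "\<sigma> \<ge> 1"
    and inner: "\<And>x. x \<in> \<Omega> \<Longrightarrow> bdist \<Omega> x = r \<Longrightarrow> a x \<le> \<sigma> * b x"
    and outer: "\<And>x. x \<in> \<Omega> \<Longrightarrow> bdist \<Omega> x = \<eta> \<Longrightarrow> a x \<le> \<sigma> * b x"
    and sub: "\<And>x. x \<in> \<Omega> \<Longrightarrow> \<eta> < bdist \<Omega> x \<Longrightarrow> bdist \<Omega> x < r \<Longrightarrow> a x > 0 \<Longrightarrow>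
      0 \<le> radius_defect (a x) (ga x) (la x)"
    and super: "\<And>x. x \<in> \<Omega> \<Longrightarrow> \<eta> < bdist \<Omega> x \<Longrightarrow> bdist \<Omega> x < r \<Longrightarrow>
      radius_defect (b x) (gb x) (lb x) \<le> 0"
    and x: "x \<in> \<Omega>" "\<eta> \<le> bdist \<Omega> x" "bdist \<Omega> x \<le> r"
  shows "a x \<le> \<sigma> * b x"
proof -
  define T where "T = {x \<in> \<Omega>. \<eta> \<le> bdist \<Omega> x \<and> bdist \<Omega> x \<le> r}"
  define S where "S = {x \<in> \<Omega>. \<eta> < bdist \<Omega> x \<and> bdist \<Omega> x < r}"
  have "open S"
  proof -
    have "S = \<Omega> \<inter> {x. \<eta> < bdist \<Omega> x} \<inter> {x. bdist \<Omega> x < r}" by (auto simp: S_def)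
    then show ?thesis
      using assms(2) by (auto intro!: open_Int open_Collect_less continuous_on_bdist)
  qed
  have ST: "S \<subseteq> T" "T \<subseteq> strip \<Omega> \<delta>"
    using assms(3,4) by (auto simp: S_def T_def strip_def)
  have "compact T" unfolding T_def by (rule compact_shell) fact+
  show ?thesis
  proof (rule radius_comparison[OF \<open>compact T\<close> \<open>open S\<close> ST(1)])
    show "continuous_on T a" "continuous_on T b"
      using ST a b by (auto intro: continuous_on_subset has_grad_laplacian_continuous_on)
    show "has_grad_laplacian S a ga la" "has_grad_laplacian S b gb lb"
      using ST a b by (auto intro: has_grad_laplacian_subset)
    show "a x \<le> \<sigma> * b x" if "x \<in> T - S" for x
      using that inner outer by (force simp: T_def S_def)
  qed (use assms in \<open>auto simp: T_def S_def\<close>)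
qed

text \<open>For a function \<open>h(s)\<close> of \<open>s = d + e\<close> the eikonal equation gives \<open>F = h (h'' + h' \<Delta>d) - (n / 2) (h'\<^sup>2 - 4)\<close>. With
\<open>h = 2 s + K s\<^sup>2\<close> one has \<open>h'\<^sup>2 - 4 = 4 K h\<close>, so that \<open>h\<close> factors out. Where \<open>h > 0\<close>, the sign is the
one of \<open>- K\<close> as soon as \<open>(n - 1) \<bar>K\<bar>\<close> exceeds \<open>\<bar>(1 + K s) \<Delta>d\<bar>\<close>.\<close>

lemma distance_barrier:
  fixes d :: "'a::euclidean_space \<Rightarrow> real"
  assumes d: "has_grad_laplacian S d g l" and eik: "\<And>x. x \<in> S \<Longrightarrow> g x \<bullet> g x = 1"
  shows "\<exists>g' l'. has_grad_laplacian S (\<lambda>x. 2 * (d x + e) + K * (d x + e)\<^sup>2) g' l' \<and>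
    (\<forall>x\<in>S. radius_defect (2 * (d x + e) + K * (d x + e)\<^sup>2) (g' x) (l' x)
       = 2 * (2 * (d x + e) + K * (d x + e)\<^sup>2) * ((1 + K * (d x + e)) * l x - (real DIM('a) - 1) * K))"
proof (intro exI conjI ballI)
  show "has_grad_laplacian S (\<lambda>x. 2 * (d x + e) + K * (d x + e)\<^sup>2)
     (\<lambda>x. (2 + 2 * K * (d x + e)) *\<^sub>R g x) (\<lambda>x. (2 + 2 * K * (d x + e)) * l x + 2 * K * (g x \<bullet> g x))"
    by (rule has_grad_laplacian_compose[OF d, where \<phi>="\<lambda>t. 2 * (t + e) + K * (t + e)\<^sup>2"
          and \<phi>'="\<lambda>t. 2 + 2 * K * (t + e)" and \<phi>''="\<lambda>t. 2 * K"])
       (auto intro!: derivative_eq_intros simp: algebra_simps)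
  fix x assume "x \<in> S"
  note 1 = eik[OF this]
  show "radius_defect (2 * (d x + e) + K * (d x + e)\<^sup>2) ((2 + 2 * K * (d x + e)) *\<^sub>R g x)
      ((2 + 2 * K * (d x + e)) * l x + 2 * K * (g x \<bullet> g x))
    = 2 * (2 * (d x + e) + K * (d x + e)\<^sup>2) * ((1 + K * (d x + e)) * l x - (real DIM('a) - 1) * K)"
    unfolding radius_defect_def by (simp add: 1 power2_eq_square) (simp add: field_simps)
qed

text \<open>The linear part is the operator \<open>L\<close>: collecting the terms with the factor \<open>2 + d W\<close> by means of
\<open>1 + d W = (2 + d W) / 2 + d W / 2\<close> leaves \<open>d (2 + d W) (L W + 2 \<Delta>d + 2 d W \<Delta>d)\<close> and a remainder that is
quadratic in \<open>W\<close>. In the remainder the factors are grouped as \<open>d \<nabla>W\<close>, which stays bounded.\<close>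

lemma expansion_defect:
  fixes d W :: "'a::euclidean_space \<Rightarrow> real"
  assumes d: "has_grad_laplacian S d g l" and eik: "\<And>x. x \<in> S \<Longrightarrow> g x \<bullet> g x = 1"
    and W: "has_grad_laplacian S W p m"
  shows "\<exists>g' l'. has_grad_laplacian S (\<lambda>x. 2 * d x + (d x)\<^sup>2 * W x) g' l' \<and>
    (\<forall>x\<in>S. radius_defect (2 * d x + (d x)\<^sup>2 * W x) (g' x) (l' x)
      = d x * (2 + d x * W x) *
          ((d x)\<^sup>2 * m x + (4 - real DIM('a)) * d x * (g x \<bullet> p x) + (2 - 2 * real DIM('a)) * W x
            + 2 * l x + 2 * d x * W x * l x)
        - real DIM('a) / 2 * (d x)\<^sup>2 * (2 * W x * (d x * (g x \<bullet> p x)) + (d x)\<^sup>2 * (p x \<bullet> p x)))"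
proof (intro exI conjI ballI)
  define n where "n = real DIM('a)"
  define g' where "g' x = (2 + 2 * d x * W x) *\<^sub>R g x + (d x)\<^sup>2 *\<^sub>R p x" for x
  define l' where "l' x = (2 + 2 * d x * W x) * l x + 2 * W x + 4 * d x * (g x \<bullet> p x) + (d x)\<^sup>2 * m x" for x
  have sq: "has_grad_laplacian S (\<lambda>x. (d x)\<^sup>2) (\<lambda>x. (2 * d x) *\<^sub>R g x)
      (\<lambda>x. 2 * d x * l x + 2 * (g x \<bullet> g x))"
    by (rule has_grad_laplacian_compose[OF d, where \<phi>="\<lambda>t. t\<^sup>2" and \<phi>'="\<lambda>t. 2 * t" and \<phi>''="\<lambda>t. 2"])
       (auto intro!: derivative_eq_intros)
  note V = has_grad_laplacian_add[OF has_grad_laplacian_cmult[OF d, of 2] has_grad_laplacian_mult[OF sq W]]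
  have "(\<lambda>x. 2 *\<^sub>R g x + ((d x)\<^sup>2 *\<^sub>R p x + W x *\<^sub>R (2 * d x) *\<^sub>R g x)) = g'"
    by (auto simp: g'_def algebra_simps)
  note V' = V[unfolded this]
  show "has_grad_laplacian S (\<lambda>x. 2 * d x + (d x)\<^sup>2 * W x) g' l'"
    by (rule has_grad_laplacian_cong[OF V']) (simp add: l'_def eik algebra_simps)
  fix x assume "x \<in> S"
  note 1 = eik[OF this]
  have gg: "g' x \<bullet> g' x = (2 + 2 * d x * W x)\<^sup>2 + 2 * (2 + 2 * d x * W x) * (d x)\<^sup>2 * (g x \<bullet> p x)
      + (d x)^4 * (p x \<bullet> p x)"
    unfolding g'_def by (simp add: inner_add_left inner_add_right 1 inner_commute power2_eq_square power4_eq_xxxx algebra_simps)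
  show "radius_defect (2 * d x + (d x)\<^sup>2 * W x) (g' x) (l' x)
      = d x * (2 + d x * W x) *
          ((d x)\<^sup>2 * m x + (4 - real DIM('a)) * d x * (g x \<bullet> p x) + (2 - 2 * real DIM('a)) * W x
            + 2 * l x + 2 * d x * W x * l x)
        - real DIM('a) / 2 * (d x)\<^sup>2 * (2 * W x * (d x * (g x \<bullet> p x)) + (d x)\<^sup>2 * (p x \<bullet> p x))"
    unfolding radius_defect_def gg l'_def n_def[symmetric]
    by (simp add: power2_eq_square power4_eq_xxxx field_simps)
qed

section \<open>Two terms of the expansion at the boundary\<close>

text \<open>The lower barrier \<open>2 s - K1 s\<^sup>2\<close> with \<open>s = d - \<epsilon>\<close> vanishes for \<open>s = 0\<close> and \<open>s = 2 / K1\<close>, so positivity of \<open>v\<close>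
on these two level sets suffices. The upper barrier \<open>2 s + K2 s\<^sup>2\<close> with \<open>s = d + \<epsilon>\<close> is at least \<open>2 \<epsilon>\<close> at the boundary,
where \<open>v\<close> tends to \<open>0\<close>, and exceeds \<open>v\<close> on an inner level set if \<open>K2\<close> is large. The shift \<open>\<epsilon>\<close> is removed at the end.\<close>

lemma boundary_expansion_first_order:
  fixes \<Omega> :: "'a::euclidean_space set"
  assumes n: "DIM('a) \<ge> 3" and bdd: "bounded \<Omega>" and op: "open \<Omega>" and "0 < \<delta>" and "0 < C"
    and d: "has_grad_laplacian (strip \<Omega> \<delta>) (bdist \<Omega>) g l"
    and eik: "\<And>x. x \<in> strip \<Omega> \<delta> \<Longrightarrow> g x \<bullet> g x = 1"
    and lC: "\<And>x. x \<in> strip \<Omega> \<delta> \<Longrightarrow> \<bar>l x\<bar> \<le> C"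
    and v: "has_grad_laplacian \<Omega> v gv lv" and vpos: "\<And>x. x \<in> \<Omega> \<Longrightarrow> v x > 0"
    and veq: "\<And>x. x \<in> \<Omega> \<Longrightarrow> radius_defect (v x) (gv x) (lv x) = 0"
    and v0: "\<And>\<epsilon>. \<epsilon> > 0 \<Longrightarrow> \<exists>\<eta>>0. \<forall>x\<in>strip \<Omega> \<eta>. v x \<le> \<epsilon>"
  obtains K r where "K > 0" "0 < r" "r < \<delta>"
    "\<And>x. x \<in> strip \<Omega> r \<Longrightarrow> \<bar>v x - 2 * bdist \<Omega> x\<bar> \<le> K * (bdist \<Omega> x)\<^sup>2"
proof -
  define n where "n = real DIM('a)"
  have n3: "n \<ge> 3" using n by (simp add: n_def)
  define D where "D = bdist \<Omega>"
  have v': "has_grad_laplacian (strip \<Omega> \<delta>) v gv lv"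
    by (rule has_grad_laplacian_subset[OF v]) (auto simp: strip_def)
  \<comment> \<open>\<open>K1 \<ge> C\<close> makes the barrier a subsolution, and \<open>K1 \<ge> 4 / \<delta>\<close> places its second zero, at
    distance \<open>\<epsilon> + 2 / K1\<close>, inside the strip.\<close>
  define K1 where "K1 = max C (4 / \<delta>)"
  have K1: "K1 > 0" "K1 \<ge> C" "2 / K1 \<le> \<delta> / 2"
  proof -
    show "K1 > 0" "K1 \<ge> C" using \<open>0 < C\<close> by (auto simp: K1_def)
    have "4 / \<delta> \<le> K1" by (simp add: K1_def)
    then show "2 / K1 \<le> \<delta> / 2" using \<open>0 < \<delta>\<close> \<open>K1 > 0\<close> by (simp add: field_simps)
  qed
  have low: "2 * D x - K1 * (D x)\<^sup>2 \<le> v x" if x: "x \<in> \<Omega>" "0 < D x" "D x < 2 / K1" for x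
  proof -
    have shifted: "2 * (D x - \<epsilon>) - K1 * (D x - \<epsilon>)\<^sup>2 \<le> v x" if \<epsilon>: "0 < \<epsilon>" "\<epsilon> < D x" "\<epsilon> < \<delta> / 2" for \<epsilon>
    proof -
      obtain g' l' where b: "has_grad_laplacian (strip \<Omega> \<delta>) (\<lambda>x. 2 * (D x + - \<epsilon>) + (- K1) * (D x + - \<epsilon>)\<^sup>2) g' l'"
        and bd0: "\<forall>x\<in>strip \<Omega> \<delta>. radius_defect (2 * (D x + - \<epsilon>) + (- K1) * (D x + - \<epsilon>)\<^sup>2) (g' x) (l' x)
           = 2 * (2 * (D x + - \<epsilon>) + (- K1) * (D x + - \<epsilon>)\<^sup>2) * ((1 + (- K1) * (D x + - \<epsilon>)) * l x - (n - 1) * (- K1))"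
        using distance_barrier[OF d eik, where K = "- K1" and e = "- \<epsilon>"] unfolding D_def n_def by blast
      note bd = bspec[OF bd0]
      have "2 * (D x + - \<epsilon>) + (- K1) * (D x + - \<epsilon>)\<^sup>2 \<le> 1 * v x"
      proof (rule shell_comparison[OF bdd op \<epsilon>(1) _ b v', where r = "\<epsilon> + 2 / K1"])
        show "\<epsilon> + 2 / K1 < \<delta>" using \<epsilon> K1 by linarith
        fix y assume y: "y \<in> \<Omega>" "\<epsilon> < bdist \<Omega> y" "bdist \<Omega> y < \<epsilon> + 2 / K1"
          and pos: "2 * (D y + - \<epsilon>) + (- K1) * (D y + - \<epsilon>)\<^sup>2 > 0"
        define s where "s = D y - \<epsilon>"
        have s: "0 < s" "K1 * s < 2" using y K1 by (auto simp: s_def D_def field_simps)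
        have yst: "y \<in> strip \<Omega> \<delta>" using y \<epsilon> K1 by (auto simp: strip_def)
        have "\<bar>(1 - K1 * s) * l y\<bar> \<le> 1 * C"
          unfolding abs_mult
        proof (rule mult_mono)
          have "\<bar>1 - t\<bar> \<le> 1" if "0 < t" "t < 2" for t :: real using that by linarith
          from this[OF mult_pos_pos[OF K1(1) s(1)] s(2)] show "\<bar>1 - K1 * s\<bar> \<le> 1" .
        qed (use lC[OF yst] in auto)
        moreover have "(n - 1) * K1 \<ge> 1 * K1" using n3 K1 by (intro mult_right_mono) auto
        ultimately have "(1 - K1 * s) * l y - (n - 1) * (- K1) \<ge> 0" using K1 by linarith
        then show "0 \<le> radius_defect (2 * (D y + - \<epsilon>) + (- K1) * (D y + - \<epsilon>)\<^sup>2) (g' y) (l' y)"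
          unfolding bd[OF yst] using pos by (intro mult_nonneg_nonneg) (auto simp: s_def)
      next
        fix y assume y: "y \<in> \<Omega>" "bdist \<Omega> y = \<epsilon> + 2 / K1"
        then show "2 * (D y + - \<epsilon>) + (- K1) * (D y + - \<epsilon>)\<^sup>2 \<le> 1 * v y"
          using vpos[OF y(1)] K1 by (simp add: D_def power2_eq_square)
      next
        fix y assume y: "y \<in> \<Omega>" "bdist \<Omega> y = \<epsilon>"
        then show "2 * (D y + - \<epsilon>) + (- K1) * (D y + - \<epsilon>)\<^sup>2 \<le> 1 * v y"
          using vpos[OF y(1)] by (simp add: D_def)
      qed (use x \<epsilon> vpos veq in \<open>auto simp: D_def\<close>)
      then show ?thesis by simp
    qed
    show ?thesis
    proof (rule tendsto_upperbound)
      show "((\<lambda>\<epsilon>. 2 * (D x - \<epsilon>) - K1 * (D x - \<epsilon>)\<^sup>2) \<longlongrightarrow> 2 * D x - K1 * (D x)\<^sup>2) (at_right 0)"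
        by (auto intro!: tendsto_eq_intros)
      show "eventually (\<lambda>\<epsilon>. 2 * (D x - \<epsilon>) - K1 * (D x - \<epsilon>)\<^sup>2 \<le> v x) (at_right 0)"
        by (rule eventually_at_rightI[of 0 "min (D x) (\<delta> / 2)"])
           (use shifted x \<open>0 < \<delta>\<close> in auto)
    qed simp
  qed
  \<comment> \<open>The width \<open>r\<close> is fixed before \<open>K2\<close>: for \<open>s \<le> 2 r\<close> one has \<open>s C \<le> 1\<close>, hence
    \<open>(1 + K2 s) \<bar>\<Delta>d\<bar> \<le> C + K2\<close>, which is at most \<open>(n - 1) K2\<close> for every \<open>K2 \<ge> C\<close>.\<close>
  define r where "r = min (\<delta> / 2) (1 / (2 * C))"
  have r: "0 < r" "r < \<delta>" "2 * r * C \<le> 1"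
  proof -
    show "0 < r" "r < \<delta>" using \<open>0 < C\<close> \<open>0 < \<delta>\<close> by (auto simp: r_def)
    have "r \<le> 1 / (2 * C)" by (simp add: r_def)
    then show "2 * r * C \<le> 1" using \<open>0 < C\<close> by (simp add: field_simps)
  qed
  have "compact {x \<in> \<Omega>. r \<le> bdist \<Omega> x \<and> bdist \<Omega> x \<le> r}"
    by (rule compact_shell[OF bdd op r(1)])
  moreover have "continuous_on {x \<in> \<Omega>. r \<le> bdist \<Omega> x \<and> bdist \<Omega> x \<le> r} v"
    using has_grad_laplacian_continuous_on[OF v] by (rule continuous_on_subset) auto
  ultimately have "bounded (v ` {x \<in> \<Omega>. r \<le> bdist \<Omega> x \<and> bdist \<Omega> x \<le> r})"
    by (intro compact_imp_bounded compact_continuous_image)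
  then obtain M where M0: "\<forall>y\<in>v ` {x \<in> \<Omega>. r \<le> bdist \<Omega> x \<and> bdist \<Omega> x \<le> r}. norm y \<le> M"
    unfolding bounded_iff by blast
  have M: "v x \<le> M" if "x \<in> \<Omega>" "bdist \<Omega> x = r" for x
    using bspec[OF M0, of "v x"] that by auto
  define K2 where "K2 = max C (M / r\<^sup>2)"
  have K2: "K2 > 0" "K2 \<ge> C" "K2 * r\<^sup>2 \<ge> M"
  proof -
    show "K2 > 0" "K2 \<ge> C" using \<open>0 < C\<close> by (auto simp: K2_def)
    have "M / r\<^sup>2 \<le> K2" by (simp add: K2_def)
    then show "K2 * r\<^sup>2 \<ge> M" using r by (simp add: field_simps)
  qed
  have upp: "v x \<le> 2 * D x + K2 * (D x)\<^sup>2" if x: "x \<in> \<Omega>" "0 < D x" "D x < r" for x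
  proof -
    have shifted: "v x \<le> 2 * (D x + \<epsilon>) + K2 * (D x + \<epsilon>)\<^sup>2" if \<epsilon>: "0 < \<epsilon>" "\<epsilon> < r" for \<epsilon>
    proof -
      obtain \<eta>0 where \<eta>0: "\<eta>0 > 0" "\<And>x. x \<in> strip \<Omega> \<eta>0 \<Longrightarrow> v x \<le> \<epsilon>" using v0[OF \<epsilon>(1)] by blast
      define \<eta> where "\<eta> = min (\<eta>0 / 2) (D x)"
      have \<eta>: "0 < \<eta>" "\<eta> < \<eta>0" "\<eta> \<le> D x" using \<eta>0 x by (auto simp: \<eta>_def)
      obtain g' l' where b: "has_grad_laplacian (strip \<Omega> \<delta>) (\<lambda>x. 2 * (D x + \<epsilon>) + K2 * (D x + \<epsilon>)\<^sup>2) g' l'"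
        and bd0: "\<forall>x\<in>strip \<Omega> \<delta>. radius_defect (2 * (D x + \<epsilon>) + K2 * (D x + \<epsilon>)\<^sup>2) (g' x) (l' x)
           = 2 * (2 * (D x + \<epsilon>) + K2 * (D x + \<epsilon>)\<^sup>2) * ((1 + K2 * (D x + \<epsilon>)) * l x - (n - 1) * K2)"
        using distance_barrier[OF d eik, where K = K2 and e = \<epsilon>] unfolding D_def n_def by blast
      note bd = bspec[OF bd0]
      have bpos: "2 * (D y + \<epsilon>) + K2 * (D y + \<epsilon>)\<^sup>2 > 0" if "0 < D y" for y
        using that \<epsilon> K2 by (intro add_pos_nonneg) auto
      have "v x \<le> 1 * (2 * (D x + \<epsilon>) + K2 * (D x + \<epsilon>)\<^sup>2)"
      proof (rule shell_comparison[OF bdd op \<eta>(1) r(2) v' b])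
        fix y assume y: "y \<in> \<Omega>" "\<eta> < bdist \<Omega> y" "bdist \<Omega> y < r"
        define s where "s = D y + \<epsilon>"
        have s: "0 < s" "s \<le> 2 * r" using y \<epsilon> \<eta> by (auto simp: s_def D_def)
        have yst: "y \<in> strip \<Omega> \<delta>" using y \<eta> r by (auto simp: strip_def)
        have "s * C \<le> 2 * r * C" using s \<open>0 < C\<close> by (intro mult_right_mono) auto
        then have sC: "s * C \<le> 1" using r by linarith
        have "(1 + K2 * s) * l y \<le> (1 + K2 * s) * C"
          using s K2 lC[OF yst] by (intro mult_left_mono) auto
        also have "\<dots> = C + K2 * (s * C)" by (simp add: algebra_simps)
        also have "\<dots> \<le> K2 + K2 * 1" using sC K2 by (intro add_mono mult_left_mono) auto
        also have "\<dots> = 2 * K2" by simp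
        also have "\<dots> \<le> (n - 1) * K2" using n3 K2 by (intro mult_right_mono) auto
        finally have "(1 + K2 * s) * l y - (n - 1) * K2 \<le> 0" by simp
        then show "radius_defect (2 * (D y + \<epsilon>) + K2 * (D y + \<epsilon>)\<^sup>2) (g' y) (l' y) \<le> 0"
          unfolding bd[OF yst] using bpos[of y] y \<eta>
          by (intro mult_nonneg_nonpos) (auto simp: s_def D_def)
      next
        fix y assume y: "y \<in> \<Omega>" "bdist \<Omega> y = r"
        have "K2 * r\<^sup>2 \<le> K2 * (r + \<epsilon>)\<^sup>2"
          using K2 \<epsilon> r by (intro mult_left_mono power_mono) auto
        with M[OF y] K2(3) have "v y \<le> K2 * (r + \<epsilon>)\<^sup>2" by linarith
        moreover have "0 \<le> 2 * (r + \<epsilon>)" using \<epsilon> r by simp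
        ultimately have "v y \<le> 2 * (r + \<epsilon>) + K2 * (r + \<epsilon>)\<^sup>2" by linarith
        then show "v y \<le> 1 * (2 * (D y + \<epsilon>) + K2 * (D y + \<epsilon>)\<^sup>2)"
          using y by (simp add: D_def)
      next
        fix y assume y: "y \<in> \<Omega>" "bdist \<Omega> y = \<eta>"
        have "v y \<le> \<epsilon>" using y \<eta> by (intro \<eta>0(2)) (auto simp: strip_def)
        moreover have "K2 * (\<eta> + \<epsilon>)\<^sup>2 \<ge> 0" using K2 by simp
        ultimately show "v y \<le> 1 * (2 * (D y + \<epsilon>) + K2 * (D y + \<epsilon>)\<^sup>2)"
          using y \<eta> \<epsilon> by (simp add: D_def)
      next
        fix y assume "y \<in> \<Omega>" "\<eta> \<le> bdist \<Omega> y"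
        then show "2 * (D y + \<epsilon>) + K2 * (D y + \<epsilon>)\<^sup>2 > 0" using \<eta> by (intro bpos) (auto simp: D_def)
      qed (use x \<eta> veq in \<open>auto simp: D_def\<close>)
      then show ?thesis by simp
    qed
    show ?thesis
    proof (rule tendsto_lowerbound)
      show "((\<lambda>\<epsilon>. 2 * (D x + \<epsilon>) + K2 * (D x + \<epsilon>)\<^sup>2) \<longlongrightarrow> 2 * D x + K2 * (D x)\<^sup>2) (at_right 0)"
        by (auto intro!: tendsto_eq_intros)
      show "eventually (\<lambda>\<epsilon>. v x \<le> 2 * (D x + \<epsilon>) + K2 * (D x + \<epsilon>)\<^sup>2) (at_right 0)"
        by (rule eventually_at_rightI[of 0 r]) (use shifted r in auto)
    qed simp
  qed
  show ?thesis
  proof (rule that[of "max K1 K2" "min r (2 / K1)"])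
    fix x assume x: "x \<in> strip \<Omega> (min r (2 / K1))"
    have "K1 * (D x)\<^sup>2 \<le> max K1 K2 * (D x)\<^sup>2" "K2 * (D x)\<^sup>2 \<le> max K1 K2 * (D x)\<^sup>2"
      by (auto intro!: mult_right_mono)
    moreover have "2 * D x - K1 * (D x)\<^sup>2 \<le> v x" "v x \<le> 2 * D x + K2 * (D x)\<^sup>2"
      using low[of x] upp[of x] x by (simp_all add: strip_def D_def)
    ultimately have "\<bar>v x - 2 * D x\<bar> \<le> max K1 K2 * (D x)\<^sup>2"
      by linarith
    then show "\<bar>v x - 2 * bdist \<Omega> x\<bar> \<le> max K1 K2 * (bdist \<Omega> x)\<^sup>2" by (simp add: D_def)
  qed (use K1 r in auto)
qed

section \<open>Three terms of the expansion at the boundary\<close>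

text \<open>The barriers \<open>2 d + d\<^sup>2 (w0 \<plusminus> A d)\<close> are used in a strip of small width \<open>\<rho>\<close> with \<open>A = B / \<rho>\<close>. The constant \<open>B = K + C0\<close>
is such that the first order bound orders the functions where \<open>d = \<rho>\<close>. As \<open>\<bar>A d\<bar> \<le> B\<close>, the
functions \<open>W = w0 \<plusminus> A d\<close> and \<open>d \<nabla>W\<close> have bounds independent of \<open>\<rho>\<close>, while the good term
\<open>A L d\<close> grows like \<open>d B / \<rho>\<close>; so it dominates once \<open>\<rho>\<close> is small. Near the boundary both \<open>v\<close> and the
barriers are \<open>2 d + O(d\<^sup>2)\<close>, hence comparable up to any factor \<open>\<sigma> > 1\<close>.\<close>

lemma boundary_expansion_second_order:
  fixes \<Omega> :: "'a::euclidean_space set"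
  assumes n: "DIM('a) \<ge> 3" and bdd: "bounded \<Omega>" and op: "open \<Omega>" and "0 < C"
    and d: "has_grad_laplacian (strip \<Omega> \<delta>) (bdist \<Omega>) g l"
    and eik: "\<And>x. x \<in> strip \<Omega> \<delta> \<Longrightarrow> g x \<bullet> g x = 1"
    and lC: "\<And>x. x \<in> strip \<Omega> \<delta> \<Longrightarrow> \<bar>l x\<bar> \<le> C"
    and v: "has_grad_laplacian \<Omega> v gv lv" and vpos: "\<And>x. x \<in> \<Omega> \<Longrightarrow> v x > 0"
    and veq: "\<And>x. x \<in> \<Omega> \<Longrightarrow> radius_defect (v x) (gv x) (lv x) = 0"
    and "K > 0" "0 < r" "r < \<delta>"
    and first: "\<And>x. x \<in> strip \<Omega> r \<Longrightarrow> \<bar>v x - 2 * bdist \<Omega> x\<bar> \<le> K * (bdist \<Omega> x)\<^sup>2"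
    and w0: "has_grad_laplacian (strip \<Omega> \<delta>) w0 p m"
    and "C0 > 0" and w0C: "\<And>x. x \<in> strip \<Omega> \<delta> \<Longrightarrow> \<bar>w0 x\<bar> \<le> C0"
    and "C1 > 0" and pC: "\<And>x. x \<in> strip \<Omega> \<delta> \<Longrightarrow> bdist \<Omega> x * norm (p x) \<le> C1"
    and eq: "\<And>x. x \<in> strip \<Omega> \<delta> \<Longrightarrow> (bdist \<Omega> x)\<^sup>2 * m x
        + (4 - real DIM('a)) * bdist \<Omega> x * (g x \<bullet> p x) + (2 - 2 * real DIM('a)) * w0 x + 2 * l x = 0"
  obtains A \<rho> where "A > 0" "\<rho> > 0"
    "\<And>x. x \<in> strip \<Omega> \<rho> \<Longrightarrow> \<bar>v x - (2 * bdist \<Omega> x + (bdist \<Omega> x)\<^sup>2 * w0 x)\<bar> \<le> A * (bdist \<Omega> x)^3"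
proof -
  define n where "n = real DIM('a)"
  have n3: "n \<ge> 3" using n by (simp add: n_def)
  define D where "D = bdist \<Omega>"
  have v': "has_grad_laplacian (strip \<Omega> \<delta>) v gv lv"
    by (rule has_grad_laplacian_subset[OF v]) (auto simp: strip_def)
  define B where "B = K + C0"
  have B: "B > 0" using \<open>K > 0\<close> \<open>C0 > 0\<close> by (simp add: B_def)
  define E where "E = C0 + C1 + B"
  have E: "E > 0" "C0 + B \<le> E" "C1 + B \<le> E" using B \<open>C0 > 0\<close> \<open>C1 > 0\<close> by (auto simp: E_def)
  \<comment> \<open>\<open>E\<close> bounds \<open>\<bar>W\<bar>\<close> and \<open>d \<bar>\<nabla>W\<bar>\<close>, and \<open>G\<close> collects the two error terms: \<open>2 W \<Delta>d\<close> and the quadratic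
    remainder.\<close>
  define G where "G = 2 * E * C + 3 * n / 2 * E\<^sup>2"
  have G: "G > 0" using E \<open>0 < C\<close> n3 by (simp add: G_def add_pos_pos)
  define \<rho> where "\<rho> = min (min (r / 2) (B / G)) (min (1 / C) (1 / E))"
  have \<rho>: "0 < \<rho>" "\<rho> < r" "\<rho> * G \<le> B" "\<rho> * C \<le> 1" "\<rho> * E \<le> 1"
  proof -
    show "0 < \<rho>" "\<rho> < r" using \<open>0 < r\<close> B G E \<open>0 < C\<close> by (auto simp: \<rho>_def)
    have "\<rho> \<le> B / G" "\<rho> \<le> 1 / C" "\<rho> \<le> 1 / E" by (auto simp: \<rho>_def)
    then show "\<rho> * G \<le> B" "\<rho> * C \<le> 1" "\<rho> * E \<le> 1"
      using G E \<open>0 < C\<close> by (simp_all add: field_simps)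
  qed
  define A where "A = B / \<rho>"
  have A: "A > 0" "A \<ge> G" "A * \<rho> = B" using B \<rho> by (auto simp: A_def field_simps)
  define W where "W c x = w0 x + c * D x" for c x
  define V where "V c x = 2 * D x + (D x)\<^sup>2 * W c x" for c x
  have Wb: "\<bar>W c x\<bar> \<le> E" if "x \<in> strip \<Omega> \<delta>" "D x \<le> \<rho>" "\<bar>c\<bar> = A" for c x
  proof -
    have Dx: "D x > 0" using that by (simp add: strip_def D_def)
    have "\<bar>c * D x\<bar> \<le> B" using that A Dx mult_left_mono[of "D x" \<rho> A] by (simp add: abs_mult)
    then show ?thesis using w0C[OF that(1)] E by (simp add: W_def)
  qed
  have DW: "\<bar>D x * W c x\<bar> \<le> 1" if "x \<in> strip \<Omega> \<delta>" "D x \<le> \<rho>" "\<bar>c\<bar> = A" for c x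
  proof -
    have "\<bar>D x * W c x\<bar> \<le> \<rho> * E"
      unfolding abs_mult using that Wb[OF that] \<rho> by (intro mult_mono) (auto simp: strip_def D_def)
    then show ?thesis using \<rho> by linarith
  qed
  have W: "has_grad_laplacian (strip \<Omega> \<delta>) (W c) (\<lambda>x. p x + c *\<^sub>R g x) (\<lambda>x. m x + c * l x)" for c
    unfolding W_def[abs_def] D_def
    by (rule has_grad_laplacian_add[OF w0 has_grad_laplacian_cmult[OF d]])
  \<comment> \<open>The factor \<open>sgn c\<close> treats the supersolution \<open>c = A\<close> and the subsolution \<open>c = - A\<close> together.\<close>
  have "\<exists>g' l'. has_grad_laplacian (strip \<Omega> \<delta>) (V c) g' l' \<and>
      (\<forall>x\<in>strip \<Omega> \<delta>. D x \<le> \<rho> \<longrightarrow> \<bar>c\<bar> = A \<longrightarrow> sgn c * radius_defect (V c x) (g' x) (l' x) \<le> 0)" for c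
  proof -
    obtain g' l' where V': "has_grad_laplacian (strip \<Omega> \<delta>) (V c) g' l'"
      and Vd0: "\<forall>x\<in>strip \<Omega> \<delta>. radius_defect (V c x) (g' x) (l' x)
      = D x * (2 + D x * W c x) *
          ((D x)\<^sup>2 * (m x + c * l x) + (4 - n) * D x * (g x \<bullet> (p x + c *\<^sub>R g x)) + (2 - 2 * n) * W c x
            + 2 * l x + 2 * D x * W c x * l x)
        - n / 2 * (D x)\<^sup>2 * (2 * W c x * (D x * (g x \<bullet> (p x + c *\<^sub>R g x)))
            + (D x)\<^sup>2 * ((p x + c *\<^sub>R g x) \<bullet> (p x + c *\<^sub>R g x)))"
      using expansion_defect[OF d eik W[of c]] unfolding D_def n_def V_def[abs_def] by blast
    note Vd = bspec[OF Vd0]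
    have "sgn c * radius_defect (V c x) (g' x) (l' x) \<le> 0"
      if x: "x \<in> strip \<Omega> \<delta>" and Dx: "D x \<le> \<rho>" and c: "\<bar>c\<bar> = A" for x
    proof -
      define s where "s = D x"
      have s: "0 < s" "s \<le> \<rho>" using x Dx by (auto simp: s_def D_def strip_def)
      define \<omega> where "\<omega> = W c x"
      define q where "q = p x + c *\<^sub>R g x"
      define k where "k = l x"
      have k: "\<bar>k\<bar> \<le> C" using lC[OF x] by (simp add: k_def)
      have \<omega>: "\<bar>\<omega>\<bar> \<le> E" using Wb[OF x Dx c] by (simp add: \<omega>_def)
      have s\<omega>: "\<bar>s * \<omega>\<bar> \<le> 1" using DW[OF x Dx c] by (simp add: \<omega>_def s_def)
      have g1: "norm (g x) = 1" using eik[OF x] by (simp add: norm_eq_sqrt_inner)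
      have sq: "s * norm q \<le> E"
      proof -
        have "norm q \<le> norm (p x) + A" unfolding q_def
          using norm_triangle_ineq[of "p x" "c *\<^sub>R g x"] g1 c by simp
        then have "s * norm q \<le> s * (norm (p x) + A)" using s by (intro mult_left_mono) auto
        also have "\<dots> = s * norm (p x) + A * s" by (simp add: algebra_simps)
        also have "\<dots> \<le> C1 + A * \<rho>"
          using pC[OF x] s A by (intro add_mono mult_left_mono) (auto simp: s_def D_def)
        finally show ?thesis using A E by simp
      qed
      have X: "\<bar>s * (g x \<bullet> q)\<bar> \<le> E"
      proof -
        have "\<bar>s * (g x \<bullet> q)\<bar> \<le> s * norm q"
          unfolding abs_mult using s Cauchy_Schwarz_ineq2[of "g x" q] g1 by (intro mult_mono) auto
        with sq show ?thesis by linarith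
      qed
      have Y: "0 \<le> s\<^sup>2 * (q \<bullet> q)" "s\<^sup>2 * (q \<bullet> q) \<le> E\<^sup>2"
      proof -
        have "s\<^sup>2 * (q \<bullet> q) = (s * norm q)\<^sup>2" by (simp add: power_mult_distrib power2_norm_eq_inner)
        then show "0 \<le> s\<^sup>2 * (q \<bullet> q)" "s\<^sup>2 * (q \<bullet> q) \<le> E\<^sup>2"
          using sq s by (auto intro!: power_mono)
      qed
      define Q where "Q = 2 * \<omega> * (s * (g x \<bullet> q)) + s\<^sup>2 * (q \<bullet> q)"
      have Q: "\<bar>Q\<bar> \<le> 3 * E\<^sup>2"
      proof -
        have "\<bar>\<omega> * (s * (g x \<bullet> q))\<bar> \<le> E * E"
          unfolding abs_mult[of \<omega>] using \<omega> X by (intro mult_mono) auto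
        then have a: "\<bar>\<omega> * (s * (g x \<bullet> q))\<bar> \<le> E\<^sup>2" by (simp only: power2_eq_square)
        have "\<bar>2 * a + b\<bar> \<le> 3 * e" if "\<bar>a\<bar> \<le> e" "0 \<le> b" "b \<le> e" for a b e :: real
          using that by linarith
        from this[OF a Y] show ?thesis unfolding Q_def by (simp only: mult.assoc)
      qed
      define P where "P = c * (s * k - 3 * (n - 2)) + 2 * \<omega> * k"
      have lin: "(D x)\<^sup>2 * (m x + c * l x) + (4 - n) * D x * (g x \<bullet> (p x + c *\<^sub>R g x)) + (2 - 2 * n) * W c x
            + 2 * l x + 2 * D x * W c x * l x = s * P"
      proof -
        have "s\<^sup>2 * m x + (4 - n) * s * (g x \<bullet> p x) + (2 - 2 * n) * w0 x + 2 * k = 0"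
          using eq[OF x] by (simp add: s_def D_def n_def k_def)
        moreover have "W c x = w0 x + c * s" by (simp add: W_def s_def)
        ultimately show ?thesis
          unfolding P_def \<omega>_def s_def[symmetric] k_def[symmetric]
          by (simp add: inner_add_right eik[OF x] power2_eq_square algebra_simps)
      qed
      have def: "radius_defect (V c x) (g' x) (l' x) = s\<^sup>2 * ((2 + s * \<omega>) * P - n / 2 * Q)"
        unfolding Vd[OF x] lin unfolding s_def[symmetric] \<omega>_def[symmetric] q_def[symmetric] Q_def[symmetric]
        by (simp add: power2_eq_square algebra_simps)
      have sc: "sgn c * c = A" "\<bar>sgn c\<bar> = 1" using c A by (auto simp: sgn_if)
      have sP: "sgn c * P \<le> - (3 * n / 2 * E\<^sup>2)"
      proof -
        have "s * k \<le> s * C" using k s by (intro mult_left_mono) auto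
        also have "\<dots> \<le> \<rho> * C" using s \<open>0 < C\<close> by (intro mult_right_mono) auto
        finally have "s * k \<le> 1" using \<rho> by linarith
        have "t - 3 * (n - 2) \<le> - 1" if "t \<le> 1" for t using that n3 by (simp add: algebra_simps)
        from this[OF \<open>s * k \<le> 1\<close>] have "s * k - 3 * (n - 2) \<le> - 1" .
        then have 1: "A * (s * k - 3 * (n - 2)) \<le> A * (-1)" using A by (intro mult_left_mono) auto
        have "\<bar>sgn c * (\<omega> * k)\<bar> \<le> E * C"
          unfolding abs_mult sc using \<omega> k E by (auto intro!: mult_mono)
        moreover have "sgn c * P = A * (s * k - 3 * (n - 2)) + 2 * (sgn c * (\<omega> * k))"
          unfolding P_def by (simp add: algebra_simps flip: sc(1))
        ultimately show ?thesis using 1 A(2) unfolding G_def by linarith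
      qed
      have "sgn c * P \<le> 0" using sP n3 zero_le_power2[of E] by (smt (verit) mult_nonneg_nonneg divide_nonneg_nonneg)
      then have "(2 + s * \<omega>) * (sgn c * P) \<le> 1 * (sgn c * P)"
        using s\<omega> by (intro mult_right_mono_neg) auto
      moreover have "\<bar>sgn c * (n / 2 * Q)\<bar> \<le> n / 2 * (3 * E\<^sup>2)"
        unfolding abs_mult sc using Q n3 by (auto intro!: mult_left_mono simp: abs_mult)
      ultimately have "(2 + s * \<omega>) * (sgn c * P) - sgn c * (n / 2 * Q) \<le> 0"
        using sP by (simp add: abs_le_iff)
      then have "s\<^sup>2 * ((2 + s * \<omega>) * (sgn c * P) - sgn c * (n / 2 * Q)) \<le> 0"
        by (intro mult_nonneg_nonpos) auto
      then show ?thesis unfolding def by (simp add: algebra_simps)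
    qed
    with V' show ?thesis by blast
  qed
  then obtain gV lV where V: "\<And>c. has_grad_laplacian (strip \<Omega> \<delta>) (V c) (gV c) (lV c)"
    and VF: "\<And>c x. x \<in> strip \<Omega> \<delta> \<Longrightarrow> D x \<le> \<rho> \<Longrightarrow> \<bar>c\<bar> = A \<Longrightarrow>
      sgn c * radius_defect (V c x) (gV c x) (lV c x) \<le> 0"
    by metis
  have \<rho>\<delta>: "\<rho> < \<delta>" using \<rho> \<open>r < \<delta>\<close> by linarith
  have inst: "x \<in> strip \<Omega> \<delta>" "x \<in> strip \<Omega> r" if "x \<in> \<Omega>" "0 < D x" "D x \<le> \<rho>" for x
    using that \<rho> \<rho>\<delta> by (auto simp: strip_def D_def)
  have Vbd: "2 * D x - E * (D x)\<^sup>2 \<le> V c x" "V c x \<le> 2 * D x + E * (D x)\<^sup>2" "V c x > 0"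
    if "x \<in> \<Omega>" "0 < D x" "D x \<le> \<rho>" "\<bar>c\<bar> = A" for c x
  proof -
    have "\<bar>(D x)\<^sup>2 * W c x\<bar> \<le> (D x)\<^sup>2 * E"
      unfolding abs_mult using Wb[of x c] inst that by (intro mult_mono) auto
    then show "2 * D x - E * (D x)\<^sup>2 \<le> V c x" "V c x \<le> 2 * D x + E * (D x)\<^sup>2"
      by (auto simp: V_def mult.commute abs_le_iff)
    have "V c x = D x * (2 + D x * W c x)" by (simp add: V_def power2_eq_square algebra_simps)
    also have "\<dots> > 0" using DW[of x c] inst that by (intro mult_pos_pos) (auto simp: abs_le_iff)
    finally show "V c x > 0" .
  qed
  \<comment> \<open>Since \<open>A \<rho> = K + C0\<close>, at distance \<open>\<rho>\<close> the barriers lie outside \<open>2 d \<plusminus> K d\<^sup>2\<close>.\<close>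
  have Vin: "V (- A) x \<le> v x" "v x \<le> V A x" if "x \<in> \<Omega>" "D x = \<rho>" for x
  proof -
    have xs: "x \<in> strip \<Omega> \<delta>" "x \<in> strip \<Omega> r" using inst[of x] that \<rho> by auto
    have "K \<le> W A x" "W (- A) x \<le> - K"
      using w0C[OF xs(1)] that A by (auto simp: W_def B_def abs_le_iff)
    then have "\<rho>\<^sup>2 * K \<le> \<rho>\<^sup>2 * W A x" and "\<rho>\<^sup>2 * W (- A) x \<le> \<rho>\<^sup>2 * (- K)"
      by (blast intro: mult_left_mono zero_le_power2)+
    then show "V (- A) x \<le> v x" "v x \<le> V A x"
      using first[OF xs(2)] that by (auto simp: V_def D_def abs_le_iff mult.commute)
  qed
  have approx: "V (- A) x \<le> \<sigma> * v x" "v x \<le> \<sigma> * V A x"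
    if x: "x \<in> \<Omega>" "0 < D x" "D x < \<rho>" and \<sigma>: "\<sigma> > 1" for x \<sigma>
  proof -
    \<comment> \<open>This \<open>\<eta>\<close> is small enough for \<open>\<sigma> (2 \<eta> - K \<eta>\<^sup>2) \<ge> 2 \<eta> + E \<eta>\<^sup>2\<close>, and likewise with \<open>K\<close> and \<open>E\<close>
      exchanged.\<close>
    define \<eta> where "\<eta> = min (D x) (2 * (\<sigma> - 1) / ((K + E) * \<sigma>))"
    have KE: "(K + E) * \<sigma> > 0" using E \<open>K > 0\<close> \<sigma> by (intro mult_pos_pos) auto
    have \<eta>: "0 < \<eta>" "\<eta> \<le> D x" using x KE \<sigma> by (auto simp: \<eta>_def)
    have "\<eta> \<le> 2 * (\<sigma> - 1) / ((K + E) * \<sigma>)" by (auto simp: \<eta>_def)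
    then have "\<eta> * ((K + E) * \<sigma>) \<le> 2 * (\<sigma> - 1)" using KE by (simp add: field_simps)
    then have "\<eta> * (\<eta> * ((K + E) * \<sigma>)) \<le> \<eta> * (2 * (\<sigma> - 1))" using \<eta> by (intro mult_left_mono) auto
    moreover have "E * \<eta>\<^sup>2 \<le> E * \<eta>\<^sup>2 * \<sigma>" "K * \<eta>\<^sup>2 \<le> K * \<eta>\<^sup>2 * \<sigma>"
      using E \<open>K > 0\<close> \<sigma> mult_left_mono[of 1 \<sigma> "E * \<eta>\<^sup>2"] mult_left_mono[of 1 \<sigma> "K * \<eta>\<^sup>2"]
      by simp_all
    ultimately have near: "2 * \<eta> + E * \<eta>\<^sup>2 \<le> \<sigma> * (2 * \<eta> - K * \<eta>\<^sup>2)" "2 * \<eta> + K * \<eta>\<^sup>2 \<le> \<sigma> * (2 * \<eta> - E * \<eta>\<^sup>2)"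
      by (auto simp: power2_eq_square algebra_simps)
    have vb: "2 * \<eta> - K * \<eta>\<^sup>2 \<le> v y" "v y \<le> 2 * \<eta> + K * \<eta>\<^sup>2" if "y \<in> \<Omega>" "D y = \<eta>" for y
      using first[of y] inst(2)[of y] that \<eta> x by (auto simp: D_def abs_le_iff)
    have Vb: "2 * \<eta> - E * \<eta>\<^sup>2 \<le> V c y" "V c y \<le> 2 * \<eta> + E * \<eta>\<^sup>2" if "y \<in> \<Omega>" "D y = \<eta>" "\<bar>c\<bar> = A" for y c
      using Vbd[of y c] that \<eta> x by auto
    have \<sigma>1: "\<sigma> \<ge> 1" using \<sigma> by simp
    show "V (- A) x \<le> \<sigma> * v x"
    proof (rule shell_comparison[OF bdd op \<eta>(1) \<rho>\<delta> V v' _ \<sigma>1])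
      fix y assume y: "y \<in> \<Omega>" "bdist \<Omega> y = \<rho>"
      have "v y \<le> \<sigma> * v y" using vpos[OF y(1)] \<sigma> by simp
      then show "V (- A) y \<le> \<sigma> * v y" using Vin[of y] y by (simp add: D_def)
    next
      fix y assume y: "y \<in> \<Omega>" "bdist \<Omega> y = \<eta>"
      have "\<sigma> * (2 * \<eta> - K * \<eta>\<^sup>2) \<le> \<sigma> * v y"
        using vb[of y] y \<sigma> by (intro mult_left_mono) (auto simp: D_def)
      then show "V (- A) y \<le> \<sigma> * v y" using Vb[of y "- A"] y near A by (simp add: D_def)
    next
      fix y assume y: "y \<in> \<Omega>" "\<eta> < bdist \<Omega> y" "bdist \<Omega> y < \<rho>"
      then show "0 \<le> radius_defect (V (- A) y) (gV (- A) y) (lV (- A) y)"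
        using VF[of y "- A"] inst(1)[of y] A \<eta> by (simp add: D_def)
    qed (use x \<eta> vpos veq in \<open>auto simp: D_def\<close>)
    show "v x \<le> \<sigma> * V A x"
    proof (rule shell_comparison[OF bdd op \<eta>(1) \<rho>\<delta> v' V _ \<sigma>1])
      fix y assume y: "y \<in> \<Omega>" "bdist \<Omega> y = \<rho>"
      have "V A y \<le> \<sigma> * V A y" using Vbd(3)[of y A] y \<sigma> \<rho> A by (simp add: D_def)
      then show "v y \<le> \<sigma> * V A y" using Vin[of y] y by (simp add: D_def)
    next
      fix y assume y: "y \<in> \<Omega>" "bdist \<Omega> y = \<eta>"
      have "\<sigma> * (2 * \<eta> - E * \<eta>\<^sup>2) \<le> \<sigma> * V A y"
        using Vb[of y A] y \<sigma> A by (intro mult_left_mono) (auto simp: D_def)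
      then show "v y \<le> \<sigma> * V A y" using vb[of y] y near by (simp add: D_def)
    next
      fix y assume y: "y \<in> \<Omega>" "\<eta> < bdist \<Omega> y" "bdist \<Omega> y < \<rho>"
      then show "radius_defect (V A y) (gV A y) (lV A y) \<le> 0"
        using VF[of y A] inst(1)[of y] A \<eta> by (simp add: D_def)
    next
      fix y assume y: "y \<in> \<Omega>" "\<eta> \<le> bdist \<Omega> y" "bdist \<Omega> y \<le> \<rho>"
      then show "V A y > 0" using Vbd(3)[of y A] A \<eta> by (simp add: D_def)
    qed (use x \<eta> veq in \<open>auto simp: D_def\<close>)
  qed
  have limit: "a \<le> b" if "\<And>\<sigma>. \<sigma> > 1 \<Longrightarrow> a \<le> \<sigma> * b" for a b :: real
  proof (rule tendsto_lowerbound)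
    show "((\<lambda>\<sigma>. \<sigma> * b) \<longlongrightarrow> b) (at_right 1)" by (auto intro!: tendsto_eq_intros)
    show "eventually (\<lambda>\<sigma>. a \<le> \<sigma> * b) (at_right 1)"
      by (rule eventually_at_rightI[of 1 2]) (use that in auto)
  qed simp
  show ?thesis
  proof (rule that[OF A(1) \<rho>(1)])
    fix x assume "x \<in> strip \<Omega> \<rho>"
    then have x: "x \<in> \<Omega>" "0 < D x" "D x < \<rho>" by (auto simp: strip_def D_def)
    have "V (- A) x \<le> v x" "v x \<le> V A x"
      using limit approx[OF x] by blast+
    then show "\<bar>v x - (2 * bdist \<Omega> x + (bdist \<Omega> x)\<^sup>2 * w0 x)\<bar> \<le> A * (bdist \<Omega> x)^3"
      unfolding V_def W_def D_def[symmetric]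
      by (simp add: abs_le_iff power2_eq_square power3_eq_cube algebra_simps)
  qed
qed

section \<open>Regularity of the data and the conclusion\<close>

lemma holder_space_2_has_grad_laplacian:
  assumes "f \<in> holder_space 2 \<alpha> U"
  shows "has_grad_laplacian U f (grad f) (laplacian f)"
  using assms by (intro has_grad_laplacianI) (auto simp: holder_space_def numeral_2_eq_2)

lemma holder_space_2_laplacian_bounded:
  assumes "f \<in> holder_space 2 \<alpha> U" "bounded U"
  obtains C where "C > 0" "\<And>x. x \<in> U \<Longrightarrow> \<bar>laplacian f x\<bar> \<le> C"
proof -
  have "\<exists>C. \<forall>x\<in>U. norm (pderiv_dir i (pderiv_dir i f) x) \<le> C" if "i \<in> Basis" for i
  proof -
    have "extends_continuously U (pderiv_dir i (pderiv_dir i f))"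
      using assms(1) that by (auto simp: holder_space_def numeral_2_eq_2)
    from extends_continuously_bounded[OF assms(2) this] show ?thesis by metis
  qed
  then obtain C where C: "\<And>i x. i \<in> Basis \<Longrightarrow> x \<in> U \<Longrightarrow> norm (pderiv_dir i (pderiv_dir i f) x) \<le> C i"
    by metis
  show ?thesis
  proof (rule that[of "\<bar>\<Sum>i\<in>Basis. C i\<bar> + 1"])
    fix x assume x: "x \<in> U"
    have "norm (laplacian f x) \<le> (\<Sum>i\<in>Basis. C i)"
      unfolding laplacian_def by (rule sum_norm_le) (use C x in blast)
    then show "\<bar>laplacian f x\<bar> \<le> \<bar>\<Sum>i\<in>Basis. C i\<bar> + 1" by simp
  qed simp
qed

lemma holder_space_Suc_grad_bounded:
  fixes f :: "'a::euclidean_space \<Rightarrow> real"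
  assumes "f \<in> holder_space (Suc k) \<alpha> U" "bounded U"
  obtains C where "C > 0" "\<And>x. x \<in> U \<Longrightarrow> norm (grad f x) \<le> C"
proof -
  have "\<exists>C. \<forall>x\<in>U. norm (pderiv_dir i f x) \<le> C" if "i \<in> Basis" for i
  proof -
    have "extends_continuously U (pderiv_dir i f)"
      using assms(1) that by (cases k) (auto simp: holder_space_def)
    from extends_continuously_bounded[OF assms(2) this] show ?thesis by metis
  qed
  then obtain C where C: "\<And>i x. i \<in> Basis \<Longrightarrow> x \<in> U \<Longrightarrow> norm (pderiv_dir i f x) \<le> C i"
    by metis
  show ?thesis
  proof (rule that[of "\<bar>\<Sum>i\<in>Basis. C i\<bar> + 1"])
    fix x assume x: "x \<in> U"
    have "norm (grad f x) \<le> (\<Sum>i\<in>Basis. C i)"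
      unfolding grad_def by (rule sum_norm_le) (use C x in auto)
    then show "norm (grad f x) \<le> \<bar>\<Sum>i\<in>Basis. C i\<bar> + 1" by simp
  qed simp
qed

text \<open>In the strip \<open>w\<close> is the quotient of \<open>d\<^sup>2 w\<close> by \<open>d\<^sup>2\<close>, hence twice differentiable. The bound for \<open>d \<nabla>w\<close> comes
from \<open>\<nabla>(d w) = d \<nabla>w + w \<nabla>d\<close>, in which the left side and \<open>w\<close> are bounded.\<close>

lemma holder_sharp_space_bounds:
  fixes \<Omega> :: "'a::euclidean_space set"
  assumes w: "w \<in> holder_sharp_space 2 \<alpha> \<Omega> \<delta>" and op: "open \<Omega>" and bdd: "bounded \<Omega>"
    and d: "has_grad_laplacian (strip \<Omega> \<delta>) (bdist \<Omega>) g l"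
    and eik: "\<And>x. x \<in> strip \<Omega> \<delta> \<Longrightarrow> g x \<bullet> g x = 1"
  obtains C0 C1 where "has_grad_laplacian (strip \<Omega> \<delta>) w (grad w) (laplacian w)"
    "C0 > 0" "\<And>x. x \<in> strip \<Omega> \<delta> \<Longrightarrow> \<bar>w x\<bar> \<le> C0"
    "C1 > 0" "\<And>x. x \<in> strip \<Omega> \<delta> \<Longrightarrow> bdist \<Omega> x * norm (grad w x) \<le> C1"
proof -
  define S where "S = strip \<Omega> \<delta>"
  have S: "open S" "bounded S"
    unfolding S_def using open_strip[OF op] bdd by (auto intro: bounded_subset simp: strip_def)
  have pos: "bdist \<Omega> x > 0" if "x \<in> S" for x using that by (simp add: S_def strip_def)
  have w': "(\<lambda>x. bdist \<Omega> x ^ j * w x) \<in> holder_space j \<alpha> S" if "j \<le> 2" for j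
    using w that by (simp add: holder_sharp_space_def S_def)
  have d': "has_grad_laplacian S (bdist \<Omega>) g l" using d by (simp add: S_def)
  have "has_grad_laplacian S (\<lambda>x. 1 / bdist \<Omega> x ^ 2) (\<lambda>x. (- 2 / bdist \<Omega> x ^ 3) *\<^sub>R g x)
     (\<lambda>x. (- 2 / bdist \<Omega> x ^ 3) * l x + (6 / bdist \<Omega> x ^ 4) * (g x \<bullet> g x))"
  proof (rule has_grad_laplacian_compose[OF d', where \<phi> = "\<lambda>t. 1 / t ^ 2" and \<phi>' = "\<lambda>t. - 2 / t ^ 3"
      and \<phi>'' = "\<lambda>t. 6 / t ^ 4"])
    fix x assume "x \<in> S"
    then have p: "bdist \<Omega> x > 0" by (rule pos)
    show "((\<lambda>t. 1 / t ^ 2) has_real_derivative - 2 / bdist \<Omega> x ^ 3) (at (bdist \<Omega> x))"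
      using p by (auto intro!: derivative_eq_intros simp: field_simps power2_eq_square power3_eq_cube)
    show "((\<lambda>t. - 2 / t ^ 3) has_real_derivative 6 / bdist \<Omega> x ^ 4) (at (bdist \<Omega> x))"
      using p by (auto intro!: derivative_eq_intros simp: field_simps power2_eq_square power3_eq_cube power4_eq_xxxx)
  qed
  note quot = has_grad_laplacian_mult[OF holder_space_2_has_grad_laplacian[OF w'[of 2, simplified]] this]
  have ext: "w x = bdist \<Omega> x ^ 2 * w x * (1 / bdist \<Omega> x ^ 2)" if "x \<in> S" for x
    using pos[OF that] by simp
  note w2 = has_grad_laplacian_transform[OF quot S(1) ext]
  have hw: "has_grad_laplacian S w (grad w) (laplacian w)"
    by (rule has_grad_laplacianI) (use has_grad_laplacianD(3,4)[OF w2 S(1)] in auto)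
  have "extends_continuously S w"
    using w'[of 0] by (simp add: holder_space_def)
  then obtain C0 where C0: "C0 > 0" "\<And>x. x \<in> S \<Longrightarrow> norm (w x) \<le> C0"
    using extends_continuously_bounded[OF S(2)] by metis
  obtain C where C: "C > 0" "\<And>x. x \<in> S \<Longrightarrow> norm (grad (\<lambda>x. bdist \<Omega> x * w x) x) \<le> C"
    using holder_space_Suc_grad_bounded[OF _ S(2), of "\<lambda>x. bdist \<Omega> x * w x" 0 \<alpha>] w'[of 1] by auto
  have "bdist \<Omega> x * norm (grad w x) \<le> C + C0" if x: "x \<in> S" for x
  proof -
    have g1: "norm (g x) = 1" using eik x by (simp add: norm_eq_sqrt_inner S_def)
    have "grad (\<lambda>x. bdist \<Omega> x * w x) x = bdist \<Omega> x *\<^sub>R grad w x + w x *\<^sub>R g x"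
      by (rule has_grad_laplacianD(1)[OF has_grad_laplacian_mult[OF d' hw] S(1) x])
    then have "bdist \<Omega> x *\<^sub>R grad w x = grad (\<lambda>x. bdist \<Omega> x * w x) x - w x *\<^sub>R g x" by simp
    then have "norm (bdist \<Omega> x *\<^sub>R grad w x) \<le> norm (grad (\<lambda>x. bdist \<Omega> x * w x) x) + norm (w x *\<^sub>R g x)"
      using norm_triangle_ineq4 by metis
    then show ?thesis using C(2)[OF x] C0(2)[OF x] g1 pos[OF x] by simp
  qed
  then show ?thesis
    using that[of C0 "C + C0"] hw C0 C unfolding S_def by simp
qed

theorem theorem1p5:
  fixes \<Omega> :: "'a::euclidean_space set"
    and \<alpha> \<delta> :: real
    and u w w0 :: "'a \<Rightarrow> real"
  assumes "DIM('a) \<ge> 3"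
    and "0 < \<alpha>" and "\<alpha> < 1"
    and "bounded \<Omega>" and "holder_domain 2 \<alpha> \<Omega>"
    and "maximal_solution \<Omega> u"
    and "admissible_width \<alpha> \<Omega> \<delta>"
    and "\<And>x. x \<in> \<Omega> \<Longrightarrow> w x = (hyperbolic_radius u x - 2 * bdist \<Omega> x) / (bdist \<Omega> x)\<^sup>2"
    and "w0 \<in> holder_sharp_space 2 \<alpha> \<Omega> \<delta>"
    and "\<And>x. x \<in> strip \<Omega> \<delta> \<Longrightarrow> L_op \<Omega> w0 x + 2 * laplacian (bdist \<Omega>) x = 0"
    and "\<And>y. y \<in> frontier \<Omega> \<Longrightarrow> w0 y = - mean_curvature \<Omega> y"
  shows "(\<lambda>x. w x - w0 x) \<in> O[near_boundary \<Omega>](bdist \<Omega>)"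
proof -
  define S where "S = strip \<Omega> \<delta>"
  have op: "open \<Omega>" using assms(5) by (simp add: holder_domain_def)
  have S: "open S" "bounded S"
    unfolding S_def using open_strip[OF op] assms(4) by (auto intro: bounded_subset simp: strip_def)
  have \<delta>: "\<delta> > 0" and dH: "bdist \<Omega> \<in> holder_space 2 \<alpha> S"
    using assms(7) by (auto simp: admissible_width_def S_def)
  define g where "g = grad (bdist \<Omega>)"
  define l where "l = laplacian (bdist \<Omega>)"
  have d: "has_grad_laplacian S (bdist \<Omega>) g l"
    unfolding g_def l_def by (rule holder_space_2_has_grad_laplacian[OF dH])
  have eik: "g x \<bullet> g x = 1" if "x \<in> S" for x
    using d that norm_gradient_bdist[of \<Omega> "g x" x]
    by (auto simp: has_grad_laplacian_def S_def strip_def)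
  obtain C where C: "C > 0" "\<And>x. x \<in> S \<Longrightarrow> \<bar>l x\<bar> \<le> C"
    unfolding l_def using holder_space_2_laplacian_bounded[OF dH S(2)] by metis
  have cs: "classical_solution \<Omega> u" using assms(6) by (simp add: maximal_solution_def)
  have uH: "has_grad_laplacian \<Omega> u (grad u) (laplacian u)"
    using cs by (intro has_grad_laplacianI) (auto simp: classical_solution_def numeral_2_eq_2)
  have upos: "u x > 0" if "x \<in> \<Omega>" for x using cs that by (simp add: classical_solution_def)
  have ueq: "laplacian u x = real DIM('a) * (real DIM('a) - 2) * u x powr ((real DIM('a) + 2) / (real DIM('a) - 2))"
    if "x \<in> \<Omega>" for x using cs that by (simp add: classical_solution_def Let_def)
  define v where "v = hyperbolic_radius u"
  obtain gv lv where v: "has_grad_laplacian \<Omega> v gv lv"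
    and veq: "\<And>x. x \<in> \<Omega> \<Longrightarrow> radius_defect (v x) (gv x) (lv x) = 0"
    using hyperbolic_radius_defect[OF assms(1) uH upos ueq] unfolding v_def by metis
  have vpos: "v x > 0" if "x \<in> \<Omega>" for x
    using upos[OF that] by (simp add: v_def hyperbolic_radius_def)
  have v0: "\<exists>\<eta>>0. \<forall>x\<in>strip \<Omega> \<eta>. v x \<le> \<epsilon>" if "\<epsilon> > 0" for \<epsilon>
    using hyperbolic_radius_vanishes[OF assms(1,5,6,4) that] unfolding v_def by metis
  obtain K r where K: "K > 0" "0 < r" "r < \<delta>"
    "\<And>x. x \<in> strip \<Omega> r \<Longrightarrow> \<bar>v x - 2 * bdist \<Omega> x\<bar> \<le> K * (bdist \<Omega> x)\<^sup>2"
    using boundary_expansion_first_order[OF assms(1,4) op \<delta> C(1) d[unfolded S_def]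
        eik[unfolded S_def] C(2)[unfolded S_def] v vpos veq v0] by metis
  obtain C0 C1 where w0: "has_grad_laplacian S w0 (grad w0) (laplacian w0)"
    "C0 > 0" "\<And>x. x \<in> S \<Longrightarrow> \<bar>w0 x\<bar> \<le> C0"
    "C1 > 0" "\<And>x. x \<in> S \<Longrightarrow> bdist \<Omega> x * norm (grad w0 x) \<le> C1"
    using holder_sharp_space_bounds[OF assms(9) op assms(4) d[unfolded S_def] eik[unfolded S_def]]
    unfolding S_def by metis
  have L: "(bdist \<Omega> x)\<^sup>2 * laplacian w0 x + (4 - real DIM('a)) * bdist \<Omega> x * (g x \<bullet> grad w0 x)
      + (2 - 2 * real DIM('a)) * w0 x + 2 * l x = 0" if "x \<in> S" for x
    using assms(10) that unfolding S_def L_op_def Let_def g_def l_def by blast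
  obtain A \<rho> where A: "A > 0" "\<rho> > 0"
    "\<And>x. x \<in> strip \<Omega> \<rho> \<Longrightarrow>
      \<bar>v x - (2 * bdist \<Omega> x + (bdist \<Omega> x)\<^sup>2 * w0 x)\<bar> \<le> A * (bdist \<Omega> x)^3"
    using boundary_expansion_second_order[OF assms(1,4) op C(1) d[unfolded S_def]
        eik[unfolded S_def] C(2)[unfolded S_def] v vpos veq K w0[unfolded S_def] L[unfolded S_def]]
    by metis
  show ?thesis
  proof (rule bigoI[of _ A])
    have "norm (w x - w0 x) \<le> A * norm (bdist \<Omega> x)" if x: "x \<in> strip \<Omega> \<rho>" for x
    proof -
      define D where "D = bdist \<Omega> x"
      have D: "D > 0" and x\<Omega>: "x \<in> \<Omega>" using x by (auto simp: strip_def D_def)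
      have "w x - w0 x = (v x - (2 * D + D\<^sup>2 * w0 x)) / D\<^sup>2"
        using D assms(8)[OF x\<Omega>] by (simp add: v_def D_def field_simps)
      then have "\<bar>w x - w0 x\<bar> \<le> A * D ^ 3 / D\<^sup>2"
        using A(3)[OF x] by (simp add: D_def divide_right_mono)
      also have "\<dots> = A * D" using D by (simp add: power2_eq_square power3_eq_cube)
      finally show ?thesis using D by (simp add: D_def)
    qed
    then show "eventually (\<lambda>x. norm (w x - w0 x) \<le> A * norm (bdist \<Omega> x)) (near_boundary \<Omega>)"
      unfolding eventually_near_boundary using A(2) by blast
  qed
qed

end
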